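(* Let $\Gamma\subset\mathbb{R}^2$ be a non-rational lattice which has a well-rounded sublattice, let $\{\pm R\}$ be its unique unordered pair of coincidence reflections, and let $\Sigma=[\Gamma:\Gamma\cap R\Gamma]$. Let $a_\Gamma(n)$ be the number of well-rounded sublattices of $\Gamma$ of index $n$. Then, as $x\to\infty$, $$A_\Gamma(x)=\sum_{n\le x}a_\Gamma(n)=\frac{\log3}{4\Sigma}\,x+O(\sqrt x).$$
   Context: A lattice in $\mathbb{R}^2$ is well-rounded if its non-zero vectors of minimal length span $\mathbb{R}^2$; a sublattice means a subgroup of finite index. A lattice is rational if its similarity class contains a lattice with rational Gram matrix. A coincidence reflection of $\Gamma$ is a reflection $R$ of $\mathbb{R}^2$ such that $\Gamma\cap R\Gamma$ has finite index in both $\Gamma$ and $R\Gamma$. *)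

theory Defs
  imports
    "HOL-Analysis.Analysis"
    "HOL-Library.Landau_Symbols"
    "HOL-Algebra.Coset"
begin

definition lattice_basis :: "real^2 \<Rightarrow> real^2 \<Rightarrow> (real^2) set \<Rightarrow> bool" where
  "lattice_basis u v \<Gamma> \<longleftrightarrow>
     u \<noteq> v \<and> independent {u, v} \<and>
     \<Gamma> = {of_int m *\<^sub>R u + of_int n *\<^sub>R v | m n :: int. True}"

definition planar_lattice :: "(real^2) set \<Rightarrow> bool" where
  "planar_lattice \<Gamma> \<longleftrightarrow> (\<exists>u v. lattice_basis u v \<Gamma>)"

definition gram_matrix :: "real^2 \<Rightarrow> real^2 \<Rightarrow> real^2^2" where
  "gram_matrix u v = vector [vector [u \<bullet> u, u \<bullet> v], vector [v \<bullet> u, v \<bullet> v]]"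

definition has_rational_gram_matrix :: "(real^2) set \<Rightarrow> bool" where
  "has_rational_gram_matrix \<Gamma> \<longleftrightarrow>
     (\<exists>u v. lattice_basis u v \<Gamma> \<and> (\<forall>i j. gram_matrix u v $ i $ j \<in> \<rat>))"

definition similar_lattices :: "(real^2) set \<Rightarrow> (real^2) set \<Rightarrow> bool" where
  "similar_lattices \<Gamma> \<Lambda> \<longleftrightarrow>
     (\<exists>c f. c > 0 \<and> orthogonal_transformation f \<and> \<Lambda> = (\<lambda>x. c *\<^sub>R f x) ` \<Gamma>)"

definition rational_lattice :: "(real^2) set \<Rightarrow> bool" where
  "rational_lattice \<Gamma> \<longleftrightarrow> (\<exists>\<Lambda>. similar_lattices \<Gamma> \<Lambda> \<and> has_rational_gram_matrix \<Lambda>)"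

definition additive_group :: "(real^2) set \<Rightarrow> (real^2) monoid" where
  "additive_group G = \<lparr>carrier = G, monoid.mult = (+), one = 0\<rparr>"

definition subgroup_index :: "(real^2) set \<Rightarrow> (real^2) set \<Rightarrow> nat" where
  "subgroup_index G H = card (rcosets\<^bsub>additive_group G\<^esub> H)"

text \<open>A subgroup of finite index; for a planar lattice \<open>\<Gamma>\<close> it is automatically a planar lattice.\<close>

definition sublattice :: "(real^2) set \<Rightarrow> (real^2) set \<Rightarrow> bool" where
  "sublattice \<Lambda> \<Gamma> \<longleftrightarrow>
     subgroup \<Lambda> (additive_group \<Gamma>) \<and> finite (rcosets\<^bsub>additive_group \<Gamma>\<^esub> \<Lambda>)"

definition minimal_vectors :: "(real^2) set \<Rightarrow> (real^2) set" where
  "minimal_vectors \<Lambda> =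
     {v \<in> \<Lambda>. v \<noteq> 0 \<and> (\<forall>w\<in>\<Lambda>. w \<noteq> 0 \<longrightarrow> norm v \<le> norm w)}"

definition well_rounded :: "(real^2) set \<Rightarrow> bool" where
  "well_rounded \<Lambda> \<longleftrightarrow> span (minimal_vectors \<Lambda>) = UNIV"

text \<open>The reflection in the line through the origin orthogonal to \<open>v\<close>.\<close>

definition is_reflection :: "(real^2 \<Rightarrow> real^2) \<Rightarrow> bool" where
  "is_reflection R \<longleftrightarrow>
     (\<exists>v. v \<noteq> 0 \<and> R = (\<lambda>x. x - (2 * (x \<bullet> v) / (v \<bullet> v)) *\<^sub>R v))"

definition coincidence_reflections :: "(real^2) set \<Rightarrow> (real^2 \<Rightarrow> real^2) set" where
  "coincidence_reflections \<Gamma> =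
     {R. is_reflection R \<and> sublattice (\<Gamma> \<inter> R ` \<Gamma>) \<Gamma> \<and> sublattice (\<Gamma> \<inter> R ` \<Gamma>) (R ` \<Gamma>)}"

definition wr_count :: "(real^2) set \<Rightarrow> nat \<Rightarrow> nat" where
  "wr_count \<Gamma> n =
     card {\<Lambda>. sublattice \<Lambda> \<Gamma> \<and> well_rounded \<Lambda> \<and> subgroup_index \<Gamma> \<Lambda> = n}"

definition wr_summatory :: "(real^2) set \<Rightarrow> real \<Rightarrow> real" where
  "wr_summatory \<Gamma> x = (\<Sum>n | 1 \<le> n \<and> real n \<le> x. real (wr_count \<Gamma> n))"

end

theory Submission
  imports Defs
begin

text \<open>
  If \<open>a, b\<close> are independent minimal vectors of a well-rounded sublattice, then they generate it, and
  \<open>a + b\<close>, \<open>a - b\<close> are orthogonal vectors of \<open>\<Gamma>\<close>. Two such orthogonal pairs with different axes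
  would force the ratio of the squared lengths on the axes, and hence \<open>\<Gamma>\<close>, to be rational. So all
  well-rounded sublattices share the axes of one reflection \<open>R\<close>, and lie in
  \<open>\<Gamma> \<inter> R\<Gamma> = {i U + j W | q divides i - j}\<close> with \<open>q \<in> {1, 2}\<close> and \<open>U\<close>, \<open>W\<close> on the axes. They are
  exactly the lattices generated by \<open>m U + n W\<close> and \<open>m U - n W\<close> with \<open>m, n > 0\<close>, \<open>q\<close> dividing
  \<open>m - n\<close>, and \<open>n |W| / (m |U|)\<close> between \<open>1 / sqrt 3\<close> and \<open>sqrt 3\<close>; such a lattice has index
  \<open>2 m n \<Sigma> / q\<close>. The theorem thus counts lattice points under a hyperbola in a sector whose slopes
  have quotient 3.
\<close>

section \<open>Lattice points under a hyperbola in a sector\<close>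

text \<open>The error is of order sqrt x because the slopes stay away from 0 and infinity: the
  region under the hyperbola then has only O(sqrt y) columns, and each column is one residue class
  in an interval, counted with error at most 1. The hyperbola \<open>m n \<le> y\<close> has y = q x
  / (2 \<Sigma>), and the congruence modulo q thins the points out by the factor 1 / q; so q
  cancels, and the constant ln 3 / (4 \<Sigma>) is the same for both shapes of the reflected part.
  The bounds 1 / sqrt 3 and sqrt 3 are the reduction condition
  \<open>2 * \<bar>a \<bullet> b\<bar> \<le> a \<bullet> a\<close> for two generators of equal
  length (an angle between 60 and 120 degrees), rewritten for the diagonals of the rhombus that they
  span. Non-rationality enters through a single relation: in integer coordinates with respect to one
  orthogonal pair u, w, the orthogonality of a second pair reads a c |u|^2 + b d |w|^2 = 0, and an
  irrational ratio |u|^2 / |w|^2 forces a c = b d = 0.\<close>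

lemma card_residue_class_interval:
  fixes A B :: real and q m :: nat
  assumes "q > 0" "0 < A" "A \<le> B"
  defines "S \<equiv> {n::nat. int q dvd int m - int n \<and> A \<le> real n \<and> real n \<le> B}"
  shows "finite S" "\<bar>real (card S) - (B - A) / q\<bar> \<le> 1"
proof -
  \<comment> \<open>The elements of \<open>S\<close> are the numbers m + k q with k in
    \<open>{a..b}\<close>. Since A > 0 these integers are positive, so \<open>nat\<close> is
    harmless.\<close>
  define a where "a = \<lceil>(A - m) / q\<rceil>"
  define b where "b = \<lfloor>(B - m) / q\<rfloor>"
  have le_iff: "a \<le> k \<longleftrightarrow> A \<le> real_of_int (int m + k * int q)" for k
    using assms(1) by (simp add: a_def ceiling_le_iff field_simps)
  have ge_iff: "k \<le> b \<longleftrightarrow> real_of_int (int m + k * int q) \<le> B" for k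
    using assms(1) by (simp add: b_def le_floor_iff field_simps)
  have "bij_betw (\<lambda>k. nat (int m + k * int q)) {a..b} S"
  proof (rule bij_betwI')
    fix k l assume "k \<in> {a..b}" "l \<in> {a..b}"
    then have "0 < real_of_int (int m + k * int q)" "0 < real_of_int (int m + l * int q)"
      using le_iff assms(2) by (auto intro: less_le_trans)
    then have "0 < int m + k * int q" "0 < int m + l * int q"
      by linarith+
    then show "(nat (int m + k * int q) = nat (int m + l * int q)) = (k = l)"
      using assms(1) by (simp add: eq_nat_nat_iff)
  next
    fix k assume k: "k \<in> {a..b}"
    then have "0 < real_of_int (int m + k * int q)"
      using le_iff[of k] assms(2) by auto
    then have "0 < int m + k * int q" by linarith
    then show "nat (int m + k * int q) \<in> S"
      using k le_iff[of k] ge_iff[of k] by (auto simp: S_def)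
  next
    fix n assume n: "n \<in> S"
    then obtain c where "int m - int n = int q * c" by (auto simp: S_def)
    then have c: "int n = int m + (-c) * int q" by (simp add: algebra_simps)
    have "real n = real_of_int (int m + (-c) * int q)" using c by (metis of_int_of_nat_eq)
    then have "a \<le> -c" "-c \<le> b" using n unfolding le_iff ge_iff by (auto simp: S_def)
    then show "\<exists>k\<in>{a..b}. n = nat (int m + k * int q)"
      using c by (intro bexI[of _ "-c"]) auto
  qed
  then show "finite S" and card: "\<bar>real (card S) - (B - A) / q\<bar> \<le> 1"
  proof -
    assume bij: "bij_betw (\<lambda>k. nat (int m + k * int q)) {a..b} S"
    show "finite S" using bij bij_betw_finite by blast
    have "card S = nat (b - a + 1)" using bij_betw_same_card[OF bij] by simp
    moreover have "(B - A) / q = (B - m) / q - (A - m) / q"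
      by (simp add: diff_divide_distrib)
    moreover have "(A - m) / q \<le> (B - m) / q" 
      using assms(1,3) by (simp add: divide_right_mono)
    \<comment> \<open>Because A \<le> B, the integer b - a + 1 is never negative, so
      \<open>nat\<close> does not truncate and only the two roundings contribute.\<close>
    ultimately show "\<bar>real (card S) - (B - A) / q\<bar> \<le> 1"
      unfolding a_def b_def by linarith
  qed
qed

text \<open>Both bounds telescope. The inequality ln t \<le> t - 1 at t = n / (n + 1) bounds 1 / (n
  + 1) above by a difference of logarithms, and at t = (n + 1) / n it bounds 1 / n below by
  one.\<close>

lemma sum_inverse_nat_bounds:
  fixes j k :: nat
  assumes "0 < j" "j \<le> k"
  shows "(\<Sum>m\<in>{j<..k}. 1 / real m) \<le> ln (k / j)"
    and "ln ((real k + 1) / (real j + 1)) \<le> (\<Sum>m\<in>{j<..k}. 1 / real m)"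
proof -
  have ins: "{j<..Suc n} = insert (Suc n) {j<..n}" if "j \<le> n" for n using that by auto
  have upper: "1 / real (Suc n) \<le> ln (real (Suc n) / n)" if "0 < n" for n
  proof -
    have "ln (real n / Suc n) \<le> real n / Suc n - 1" using that by (intro ln_le_minus_one) simp
    then show ?thesis using that by (simp add: ln_div field_simps)
  qed
  have lower: "ln ((real n + 1) / n) \<le> 1 / n" if "0 < n" for n :: nat
  proof -
    have "ln ((real n + 1) / n) \<le> (real n + 1) / n - 1" using that by (intro ln_le_minus_one) simp
    then show ?thesis using that by (simp add: field_simps)
  qed
  show "(\<Sum>m\<in>{j<..k}. 1 / real m) \<le> ln (k / j)"
    using assms(2)
  proof (induction k rule: dec_induct)
    case (step n)
    have "0 < n" using step assms by simp
    then show ?case using step upper[of n] assms(1) ins[of n] 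
      by (simp add: ln_div)
  qed (use assms in simp)
  show "ln ((real k + 1) / (real j + 1)) \<le> (\<Sum>m\<in>{j<..k}. 1 / real m)"
    using assms(2)
  proof (induction k rule: dec_induct)
    case (step n)
    have "ln (real (Suc n) + 1) - ln (real n + 1) \<le> 1 / real (Suc n)"
      using lower[of "Suc n"] by (simp add: ln_div add.commute)
    then show ?case using step assms(1) by (simp add: ins ln_div)
  qed (use assms in simp)
qed

text \<open>Replacing the integer ends by real ones costs something only at the lower end: j \<le>
  M1 < j + 1 gives logarithms of size at most 2 / M1, where M1 \<ge> 1 provides M1 \<le> 2 j. At the
  upper end k \<le> M2 < k + 1 has the favourable sign in both directions.\<close>

lemma sum_inverse_approx:
  fixes M1 M2 :: real
  assumes "1 \<le> M1" "M1 \<le> M2"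
  shows "\<bar>(\<Sum>m\<in>{nat \<lfloor>M1\<rfloor><..nat \<lfloor>M2\<rfloor>}. 1 / real m) - ln (M2 / M1)\<bar> \<le> 2 / M1"
proof -
  define j k where "j = nat \<lfloor>M1\<rfloor>" and "k = nat \<lfloor>M2\<rfloor>"
  have j: "real j \<le> M1" "M1 < real j + 1" "1 \<le> j" using assms(1) unfolding j_def by linarith+
  have k: "real k \<le> M2" "M2 < real k + 1" "j \<le> k" using assms unfolding k_def j_def by linarith+
  note b = sum_inverse_nat_bounds[of j k]
  have "ln (k / j) \<le> ln (M2 / M1) + 2 / M1"
  proof -
    have "ln (M1 / j) \<le> M1 / j - 1" using j assms by (intro ln_le_minus_one) simp
    also have "\<dots> = (M1 - j) / j" using j by (simp add: field_simps)
    also have "\<dots> \<le> 1 / j" using j by (intro divide_right_mono) auto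
    also have "1 / j \<le> 2 / M1"
    proof -
      have "M1 \<le> 2 * real j" "0 < real j" using j by linarith+
      then show ?thesis using assms(1) by (simp add: field_simps)
    qed
    finally have "ln (M1 / j) \<le> 2 / M1" .
    moreover have "ln (k / j) = ln k - ln j" "ln (M2 / M1) = ln M2 - ln M1" "ln (M1 / j) = ln M1 - ln j"
      using j k assms by (simp_all add: ln_div)
    moreover have "ln k \<le> ln M2" using j k by (intro ln_mono) auto
    ultimately show ?thesis by linarith
  qed
  moreover have "ln (M2 / M1) - 2 / M1 \<le> ln ((real k + 1) / (real j + 1))"
  proof -
    have "ln ((real j + 1) / M1) \<le> (real j + 1) / M1 - 1" using j assms by (intro ln_le_minus_one) simp
    also have "\<dots> = (real j + 1 - M1) / M1" using assms by (simp add: field_simps)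
    also have "\<dots> \<le> 2 / M1" using j assms by (intro divide_right_mono) auto
    finally have "ln ((real j + 1) / M1) \<le> 2 / M1" .
    moreover have "ln ((real k + 1) / (real j + 1)) = ln (real k + 1) - ln (real j + 1)"
      "ln (M2 / M1) = ln M2 - ln M1" "ln ((real j + 1) / M1) = ln (real j + 1) - ln M1"
      using j k assms by (simp_all add: ln_div)
    moreover have "ln M2 \<le> ln (real k + 1)" using j k assms by (intro ln_mono) auto
    ultimately show ?thesis by linarith
  qed
  ultimately have "\<bar>(\<Sum>m\<in>{j<..k}. 1 / real m) - ln (M2 / M1)\<bar> \<le> 2 / M1"
    using b j k by linarith
  then show ?thesis unfolding j_def k_def .
qed

text \<open>With M - 1 < k \<le> M, the number k (k + 1) lies between (M - 1) M and M (M + 1). For M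
  < 1 the lower bound is not positive, so it holds trivially.\<close>

lemma sum_nat_floor_approx:
  fixes M :: real
  assumes "0 \<le> M"
  shows "\<bar>(\<Sum>m\<in>{0<..nat \<lfloor>M\<rfloor>}. real m) - M\<^sup>2 / 2\<bar> \<le> M / 2"
proof -
  define k where "k = nat \<lfloor>M\<rfloor>"
  have k: "real k \<le> M" "M < real k + 1" using assms unfolding k_def by linarith+
  have "(\<Sum>m\<in>{0<..k}. real m) = real k * (real k + 1) / 2"
  proof (induction k)
    case (Suc n)
    have "{0<..Suc n} = insert (Suc n) {0<..n}" by auto
    with Suc show ?case by (simp add: field_simps)
  qed simp
  moreover have "real k * (real k + 1) \<le> M * (M + 1)"
    using k by (intro mult_mono) auto
  moreover have "(M - 1) * M \<le> real k * (real k + 1)"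
  proof (cases "M \<ge> 1")
    case True
    then show ?thesis using k by (intro mult_mono) auto
  next
    case False
    then have "(M - 1) * M \<le> 0" using assms by (simp add: mult_nonpos_nonneg)
    then show ?thesis by (smt (verit) mult_nonneg_nonneg of_nat_0_le_iff)
  qed
  ultimately have "\<bar>(\<Sum>m\<in>{0<..k}. real m) - M\<^sup>2 / 2\<bar> \<le> M / 2"
    by (simp add: field_simps power2_eq_square abs_le_iff)
  then show ?thesis unfolding k_def .
qed

definition sector_points :: "nat \<Rightarrow> real \<Rightarrow> real \<Rightarrow> real \<Rightarrow> (nat \<times> nat) set" where
  "sector_points q \<alpha> \<beta> y = {(m, n). 0 < m \<and> 0 < n \<and> int q dvd int m - int n \<and>
     \<alpha> * real m \<le> real n \<and> real n \<le> \<beta> * real m \<and> real m * real n \<le> y}"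

text \<open>The points are counted by columns. For fixed m the ordinate runs through a residue class
  modulo q from \<alpha> m up to the ray \<beta> m or the hyperbola y / m, whichever is lower. In
  the error constant, 1 / sqrt \<alpha> accounts for the rounding in the columns; the other two
  terms come from comparing the sum of the column lengths with an area.\<close>

lemma
  fixes \<alpha> \<beta> y :: real and q :: nat
  assumes "q > 0" "0 < \<alpha>" "\<alpha> < \<beta>" "\<beta> \<le> y"
  shows finite_sector_points: "finite (sector_points q \<alpha> \<beta> y)"
    and card_sector_points: "\<bar>real (card (sector_points q \<alpha> \<beta> y)) - y * ln (\<beta> / \<alpha>) / (2 * q)\<bar>
           \<le> (1 / sqrt \<alpha> + 3 * sqrt \<beta> + sqrt \<alpha>) * sqrt y"
proof -
  \<comment> \<open>The abscissae at which the hyperbola meets the rays of slope \<beta> and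
    \<alpha>. The hypothesis \<open>\<beta> \<le> y\<close> makes M1 \<ge> 1, as the harmonic sum
    estimate requires.\<close>
  define M1 M2 where "M1 = sqrt (y / \<beta>)" and "M2 = sqrt (y / \<alpha>)"
  define j k where "j = nat \<lfloor>M1\<rfloor>" and "k = nat \<lfloor>M2\<rfloor>"
  have pos: "0 < y" "0 < \<beta>" using assms by auto
  have M1: "1 \<le> M1" and M12: "M1 \<le> M2" 
    using assms pos by (auto simp: M1_def M2_def field_simps)
  have sq: "M1\<^sup>2 = y / \<beta>" "M2\<^sup>2 = y / \<alpha>"
    using assms pos by (auto simp: M1_def M2_def)
  have le_j: "m \<le> j \<longleftrightarrow> \<beta> * m * m \<le> y" for m :: nat
  proof -
    have "m \<le> j \<longleftrightarrow> real m \<le> M1" unfolding j_def using M1 by (auto simp: le_nat_iff le_floor_iff)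
    also have "\<dots> \<longleftrightarrow> (real m)\<^sup>2 \<le> y / \<beta>" 
      unfolding M1_def using real_le_rsqrt real_sqrt_le_iff
      by (smt (verit) of_nat_0_le_iff real_sqrt_abs)
    finally show ?thesis using pos by (simp add: field_simps power2_eq_square)
  qed
  have le_k: "m \<le> k \<longleftrightarrow> \<alpha> * m * m \<le> y" for m :: nat
  proof -
    have "m \<le> k \<longleftrightarrow> real m \<le> M2" unfolding k_def using M1 M12 by (auto simp: le_nat_iff le_floor_iff)
    also have "\<dots> \<longleftrightarrow> (real m)\<^sup>2 \<le> y / \<alpha>" 
      unfolding M2_def using real_le_rsqrt real_sqrt_le_iff
      by (smt (verit) of_nat_0_le_iff real_sqrt_abs)
    finally show ?thesis using assms by (simp add: field_simps power2_eq_square)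
  qed
  have jk: "j \<le> k" using M12 unfolding j_def k_def by (simp add: floor_mono nat_mono)
  \<comment> \<open>Up to \<open>j\<close> the ray of slope \<beta> is the upper boundary, beyond it
    the hyperbola; beyond \<open>k\<close> the hyperbola is below the ray of slope \<alpha> and the
    columns are empty.\<close>
  define h where "h m = (if m \<le> j then \<beta> * real m else y / m)" for m :: nat
  define S where "S m = {n::nat. int q dvd int m - int n \<and> \<alpha> * m \<le> n \<and> n \<le> h m}" for m :: nat
  have h: "\<alpha> * m \<le> h m" if "0 < m" "m \<le> k" for m
    using that assms le_k[of m] by (auto simp: h_def field_simps)
  have S: "finite (S m)" "\<bar>real (card (S m)) - (h m - \<alpha> * m) / q\<bar> \<le> 1" if "m \<in> {0<..k}" for m
    unfolding S_def 
    using that h[of m] assms card_residue_class_interval[of q "\<alpha> * m" "h m" m] by auto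
  have eq: "sector_points q \<alpha> \<beta> y = Sigma {0<..k} S"
  proof -
    have "0 < m \<and> 0 < n \<and> \<alpha> * m \<le> n \<and> n \<le> \<beta> * m \<and> real m * real n \<le> y \<longleftrightarrow>
        (0 < m \<and> m \<le> k) \<and> \<alpha> * m \<le> n \<and> n \<le> h m" for m n :: nat
    proof (cases "0 < m")
      case True
      have 1: "m \<le> k" "0 < n" if "\<alpha> * m \<le> n" "real m * real n \<le> y"
      proof -
        have "\<alpha> * m * m \<le> n * real m" using that True by (intro mult_right_mono) auto
        then show "m \<le> k" using that le_k[of m] by (simp add: mult.commute)
      qed (use that True assms in \<open>smt (verit) mult_pos_pos of_nat_0_less_iff\<close>)
      have 2: "0 < n" if "\<alpha> * m \<le> n"
        using that True assms by (smt (verit) mult_pos_pos of_nat_0_less_iff)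
      show ?thesis
      proof (cases "m \<le> j")
        case mj: True
        have "real m * real n \<le> y" if "n \<le> \<beta> * m"
        proof -
          have "real m * n \<le> m * (\<beta> * m)" using that by (intro mult_left_mono) auto
          then show ?thesis using mj le_j[of m] by (simp add: algebra_simps)
        qed
        then show ?thesis using True mj jk 2 unfolding h_def if_P[OF mj] by (meson order_trans)
      next
        case False
        have "n \<le> \<beta> * m" if "real m * real n \<le> y"
        proof (rule ccontr)
          assume "\<not> n \<le> \<beta> * m"
          then have "m * (\<beta> * m) \<le> m * real n" by (intro mult_left_mono) auto
          moreover have "y < m * (\<beta> * m)" using False le_j[of m] by (simp add: mult_ac)
          ultimately show False using that by linarith
        qed
        moreover have "n \<le> y / m \<longleftrightarrow> real m * real n \<le> y"
          using True by (simp add: pos_le_divide_eq mult.commute)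
        ultimately show ?thesis using True 1 2 unfolding h_def if_not_P[OF False] by meson
      qed
    qed simp
    then show ?thesis unfolding sector_points_def S_def set_eq_iff split_paired_All
      mem_Collect_eq case_prod_conv mem_Sigma_iff greaterThanAtMost_iff by meson
  qed
  show "finite (sector_points q \<alpha> \<beta> y)" unfolding eq using S by auto
  define T where "T = (\<Sum>m\<in>{0<..k}. h m - \<alpha> * m)"
  have T: "\<bar>T - y * ln (\<beta> / \<alpha>) / 2\<bar> \<le> (3 * sqrt \<beta> + sqrt \<alpha>) * sqrt y"
  proof -
    have split: "{0<..k} = {0<..j} \<union> {j<..k}" "{0<..j} \<inter> {j<..k} = {}" using jk by auto
    have "(\<Sum>m\<in>{0<..k}. h m) = (\<Sum>m\<in>{0<..j}. h m) + (\<Sum>m\<in>{j<..k}. h m)"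
      unfolding split(1) by (rule sum.union_disjoint) auto
    also have "(\<Sum>m\<in>{0<..j}. h m) = \<beta> * (\<Sum>m\<in>{0<..j}. real m)"
      unfolding sum_distrib_left by (rule sum.cong) (auto simp: h_def)
    also have "(\<Sum>m\<in>{j<..k}. h m) = y * (\<Sum>m\<in>{j<..k}. 1 / real m)"
      unfolding sum_distrib_left by (rule sum.cong) (auto simp: h_def)
    finally have T_eq: "T = \<beta> * (\<Sum>m\<in>{0<..j}. real m) + y * (\<Sum>m\<in>{j<..k}. 1 / real m)
        - \<alpha> * (\<Sum>m\<in>{0<..k}. real m)" (is "_ = \<beta> * ?a + y * ?b - \<alpha> * ?c")
      unfolding T_def by (simp add: sum_subtractf sum_distrib_left)
    have "\<bar>?a - M1\<^sup>2 / 2\<bar> \<le> M1 / 2" "\<bar>?c - M2\<^sup>2 / 2\<bar> \<le> M2 / 2"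
      unfolding j_def k_def using M1 M12 by (intro sum_nat_floor_approx; simp)+
    then have "\<beta> * \<bar>?a - M1\<^sup>2 / 2\<bar> \<le> \<beta> * (M1 / 2)" "\<alpha> * \<bar>?c - M2\<^sup>2 / 2\<bar> \<le> \<alpha> * (M2 / 2)"
      using assms by (auto intro!: mult_left_mono)
    then have "\<bar>\<beta> * (?a - M1\<^sup>2 / 2)\<bar> \<le> \<beta> * M1 / 2" "\<bar>\<alpha> * (?c - M2\<^sup>2 / 2)\<bar> \<le> \<alpha> * M2 / 2"
      using assms by (simp_all add: abs_mult)
    \<comment> \<open>The triangles under the two rays have the same area y / 2 and cancel. What
      remains is y ln (M2 / M1), half of y ln (\<beta> / \<alpha>).\<close>
    moreover have "\<beta> * (?a - M1\<^sup>2 / 2) = \<beta> * ?a - y / 2" "\<alpha> * (?c - M2\<^sup>2 / 2) = \<alpha> * ?c - y / 2"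
      unfolding sq using assms pos by (simp_all add: field_simps)
    moreover have "\<bar>?b - ln (M2 / M1)\<bar> \<le> 2 / M1"
      unfolding j_def k_def using M1 M12 by (rule sum_inverse_approx)
    then have "y * \<bar>?b - ln (M2 / M1)\<bar> \<le> y * (2 / M1)" using pos by (intro mult_left_mono) auto
    then have "\<bar>y * ?b - y * ln (M2 / M1)\<bar> \<le> 2 * (y / M1)"
      using pos by (simp add: abs_mult mult.commute flip: right_diff_distrib)
    moreover have "ln (M2 / M1) = ln (\<beta> / \<alpha>) / 2"
      using assms pos by (simp add: M1_def M2_def ln_div ln_sqrt real_sqrt_divide field_simps)
    moreover have "y / M1 = sqrt \<beta> * sqrt y" "\<beta> * M1 = sqrt \<beta> * sqrt y" "\<alpha> * M2 = sqrt \<alpha> * sqrt y"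
      using assms pos by (auto simp: M1_def M2_def real_sqrt_divide field_simps)
    moreover have "sqrt \<beta> * sqrt y \<ge> 0" "sqrt \<alpha> * sqrt y \<ge> 0" using assms pos by auto
    ultimately have "\<bar>T - y * (ln (\<beta> / \<alpha>) / 2)\<bar> \<le> 3 * (sqrt \<beta> * sqrt y) + sqrt \<alpha> * sqrt y"
      unfolding T_eq by (simp only:)
    then show ?thesis by (simp add: distrib_right)
  qed
  have "real (card (sector_points q \<alpha> \<beta> y)) = (\<Sum>m\<in>{0<..k}. real (card (S m)))"
    unfolding eq using S by (simp add: card_SigmaI)
  then have "\<bar>real (card (sector_points q \<alpha> \<beta> y)) - T / q\<bar> =
      \<bar>\<Sum>m\<in>{0<..k}. real (card (S m)) - (h m - \<alpha> * m) / q\<bar>"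
    unfolding T_def sum_divide_distrib by (simp add: sum_subtractf)
  also have "\<dots> \<le> (\<Sum>m\<in>{0<..k}. 1)"
    by (rule order_trans[OF sum_abs]) (intro sum_mono S)
  also have "\<dots> \<le> M2" using M1 M12 by (simp add: k_def)
  also have "M2 = 1 / sqrt \<alpha> * sqrt y" by (simp add: M2_def real_sqrt_divide)
  finally have 1: "\<bar>real (card (sector_points q \<alpha> \<beta> y)) - T / q\<bar> \<le> 1 / sqrt \<alpha> * sqrt y" .
  have "T / q - y * ln (\<beta> / \<alpha>) / (2 * q) = (T - y * ln (\<beta> / \<alpha>) / 2) / q"
    by (simp add: diff_divide_distrib)
  then have "\<bar>T / q - y * ln (\<beta> / \<alpha>) / (2 * q)\<bar> = \<bar>T - y * ln (\<beta> / \<alpha>) / 2\<bar> / q"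
    by simp
  \<comment> \<open>Division by q \<ge> 1 does not enlarge the error, so the constant can be
    independent of q.\<close>
  also have "\<dots> \<le> \<bar>T - y * ln (\<beta> / \<alpha>) / 2\<bar> / 1"
    using assms by (intro divide_left_mono) auto
  finally have 2: "\<bar>T / q - y * ln (\<beta> / \<alpha>) / (2 * q)\<bar> \<le> (3 * sqrt \<beta> + sqrt \<alpha>) * sqrt y"
    using T by simp
  with 1 2 show "\<bar>real (card (sector_points q \<alpha> \<beta> y)) - y * ln (\<beta> / \<alpha>) / (2 * q)\<bar>
           \<le> (1 / sqrt \<alpha> + 3 * sqrt \<beta> + sqrt \<alpha>) * sqrt y"
    by (simp add: algebra_simps)
qed

section \<open>Index of additive subgroups of the plane\<close>

text \<open>The subgroup criterion on plain sets. No ambient group occurs, so one fact about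
  \<open>H\<close> serves for every lattice that contains it.\<close>

definition additive_subgroup :: "(real^2) set \<Rightarrow> bool" where
  "additive_subgroup H \<longleftrightarrow> 0 \<in> H \<and> (\<forall>x\<in>H. \<forall>y\<in>H. x - y \<in> H)"

lemma additive_subgroupD:
  assumes "additive_subgroup H"
  shows additive_subgroup_zero: "0 \<in> H"
    and additive_subgroup_diff: "x \<in> H \<Longrightarrow> y \<in> H \<Longrightarrow> x - y \<in> H"
    and additive_subgroup_uminus: "x \<in> H \<Longrightarrow> - x \<in> H"
    and additive_subgroup_add: "x \<in> H \<Longrightarrow> y \<in> H \<Longrightarrow> x + y \<in> H"
proof -
  show 0: "0 \<in> H" and d: "x \<in> H \<Longrightarrow> y \<in> H \<Longrightarrow> x - y \<in> H" for x y
    using assms by (auto simp: additive_subgroup_def)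
  show m: "x \<in> H \<Longrightarrow> - x \<in> H" for x using 0 d[of 0 x] by simp
  show "x \<in> H \<Longrightarrow> y \<in> H \<Longrightarrow> x + y \<in> H" using d[of x "- y"] m[of y] by simp
qed

lemma additive_subgroup_scale:
  assumes "additive_subgroup H" "x \<in> H"
  shows "of_int k *\<^sub>R x \<in> H"
proof -
  have nat: "real n *\<^sub>R x \<in> H" for n
    by (induction n) (auto simp: additive_subgroupD[OF assms(1)] assms(2) scaleR_left_distrib)
  show ?thesis
  proof (cases "k \<ge> 0")
    case True
    then show ?thesis using nat[of "nat k"] by simp
  next
    case False
    then show ?thesis using additive_subgroup_uminus[OF assms(1) nat[of "nat (- k)"]] by simp
  qed
qed

text \<open>Independence of the generators is kept apart, in \<open>coords_unique\<close>, so that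
  subgroup and inclusion facts hold for arbitrary generators.\<close>

definition int_span :: "real^2 \<Rightarrow> real^2 \<Rightarrow> (real^2) set" where
  "int_span u v = {of_int m *\<^sub>R u + of_int n *\<^sub>R v | m n :: int. True}"

lemma int_spanI: "of_int m *\<^sub>R u + of_int n *\<^sub>R v \<in> int_span u v"
  by (auto simp: int_span_def)

lemma int_spanE:
  assumes "x \<in> int_span u v"
  obtains m n :: int where "x = of_int m *\<^sub>R u + of_int n *\<^sub>R v"
  using assms by (auto simp: int_span_def)

lemma int_span_gens: "u \<in> int_span u v" "v \<in> int_span u v"
  using int_spanI[of 1 u 0 v] int_spanI[of 0 u 1 v] by auto

lemma additive_subgroup_int_span: "additive_subgroup (int_span u v)"
  unfolding additive_subgroup_def
proof (intro conjI ballI)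
  show "0 \<in> int_span u v" using int_spanI[of 0 u 0 v] by simp
  fix x y assume "x \<in> int_span u v" "y \<in> int_span u v"
  then obtain a b c d :: int where
    "x = of_int a *\<^sub>R u + of_int b *\<^sub>R v" "y = of_int c *\<^sub>R u + of_int d *\<^sub>R v"
    by (auto simp: int_span_def)
  then have "x - y = of_int (a - c) *\<^sub>R u + of_int (b - d) *\<^sub>R v"
    by (simp add: scaleR_left_diff_distrib)
  then show "x - y \<in> int_span u v" using int_spanI by metis
qed

lemma int_span_subset:
  assumes "additive_subgroup H" "u \<in> H" "v \<in> H"
  shows "int_span u v \<subseteq> H"
  using assms by (auto simp: int_span_def intro!: additive_subgroup_add additive_subgroup_scale)

lemma group_additive_group:
  assumes "additive_subgroup G"
  shows "group (additive_group G)"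
proof (rule groupI)
  show "\<exists>y\<in>carrier (additive_group G). y \<otimes>\<^bsub>additive_group G\<^esub> x = \<one>\<^bsub>additive_group G\<^esub>"
    if "x \<in> carrier (additive_group G)" for x
    using that additive_subgroup_uminus[OF assms, of x]
    by (intro bexI[of _ "- x"]) (auto simp: additive_group_def)
qed (auto simp: additive_group_def additive_subgroupD[OF assms] add.assoc)

lemma inv_additive_group:
  assumes "additive_subgroup G" "x \<in> G"
  shows "inv\<^bsub>additive_group G\<^esub> x = - x"
  by (rule group.inv_equality[OF group_additive_group[OF assms(1)]])
    (auto simp: additive_group_def additive_subgroupD[OF assms(1)] assms(2))

lemma subgroup_additive_group_iff:
  assumes "additive_subgroup G"
  shows "subgroup H (additive_group G) \<longleftrightarrow> H \<subseteq> G \<and> additive_subgroup H"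
proof
  assume H: "subgroup H (additive_group G)"
  then have sub: "H \<subseteq> G" and 0: "0 \<in> H"
    and add: "\<And>x y. x \<in> H \<Longrightarrow> y \<in> H \<Longrightarrow> x + y \<in> H"
    by (auto simp: subgroup_def additive_group_def)
  have neg: "- x \<in> H" if "x \<in> H" for x
    using subgroup.m_inv_closed[OF H that] inv_additive_group[OF assms] sub that by auto
  have "x - y \<in> H" if "x \<in> H" "y \<in> H" for x y using add[OF that(1) neg[OF that(2)]] by simp
  then show "H \<subseteq> G \<and> additive_subgroup H" using sub 0 by (auto simp: additive_subgroup_def)
next
  assume H: "H \<subseteq> G \<and> additive_subgroup H"
  show "subgroup H (additive_group G)"
  proof (rule subgroup.intro)
    show "inv\<^bsub>additive_group G\<^esub> x \<in> H" if "x \<in> H" for x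
      using inv_additive_group[OF assms, of x] H that by (auto simp: additive_subgroup_uminus)
  qed (use H in \<open>auto simp: additive_group_def additive_subgroupD\<close>)
qed

lemma coset_eq_iff:
  fixes x y :: "real^2"
  assumes "additive_subgroup H"
  shows "(\<lambda>h. h + x) ` H = (\<lambda>h. h + y) ` H \<longleftrightarrow> x - y \<in> H"
proof
  assume "(\<lambda>h. h + x) ` H = (\<lambda>h. h + y) ` H"
  moreover have "0 + x \<in> (\<lambda>h. h + x) ` H" using additive_subgroup_zero[OF assms] by blast
  ultimately have "0 + x \<in> (\<lambda>h. h + y) ` H" by simp
  then show "x - y \<in> H" by auto
next
  have sub: "(\<lambda>h. h + x) ` H \<subseteq> (\<lambda>h. h + y) ` H" if "x - y \<in> H" for x y :: "real^2"
  proof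
    fix z assume "z \<in> (\<lambda>h. h + x) ` H"
    then obtain h where "h \<in> H" "z = h + x" by auto
    then show "z \<in> (\<lambda>h. h + y) ` H"
      using additive_subgroup_add[OF assms \<open>h \<in> H\<close> that] by (intro image_eqI[of _ _ "h + (x - y)"]) auto
  qed
  assume xy: "x - y \<in> H"
  then have "y - x \<in> H" using additive_subgroup_uminus[OF assms xy] by simp
  then show "(\<lambda>h. h + x) ` H = (\<lambda>h. h + y) ` H" using sub xy by (simp add: subset_antisym)
qed

text \<open>A function that separates the points of \<open>G\<close> exactly as the cosets of
  \<open>H\<close> do has an image in bijection with the coset set. Indices are computed below by
  choosing such an \<open>f\<close> whose image is evident.\<close>

lemma
  assumes "additive_subgroup H"
    and "\<And>x y. x \<in> G \<Longrightarrow> y \<in> G \<Longrightarrow> f x = f y \<longleftrightarrow> x - y \<in> H"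
  shows finite_rcosets_iff: "finite (rcosets\<^bsub>additive_group G\<^esub> H) \<longleftrightarrow> finite (f ` G)"
    and subgroup_index_eq_card: "subgroup_index G H = card (f ` G)"
proof -
  define c where "c x = (\<lambda>h. h + x) ` H" for x :: "real^2"
  have c: "c x = c y \<longleftrightarrow> x - y \<in> H" for x y unfolding c_def by (rule coset_eq_iff[OF assms(1)])
  have rc: "rcosets\<^bsub>additive_group G\<^esub> H = c ` G"
    by (auto simp: RCOSETS_def r_coset_def additive_group_def c_def)
  have "bij_betw (\<lambda>C. f (SOME x. x \<in> G \<and> c x = C)) (c ` G) (f ` G)"
  proof -
    have some: "(SOME y. y \<in> G \<and> c y = c x) \<in> G \<and> c (SOME y. y \<in> G \<and> c y = c x) = c x" if "x \<in> G" for x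
      using that by (rule_tac someI) auto
    then have f: "f (SOME y. y \<in> G \<and> c y = c x) = f x" if "x \<in> G" for x
      using that assms(2) c by blast
    have "f x = f y \<longleftrightarrow> c x = c y" if "x \<in> G" "y \<in> G" for x y using that assms(2) c by blast
    then show ?thesis
      by (intro bij_betwI') (auto simp: f)
  qed
  then show "finite (rcosets\<^bsub>additive_group G\<^esub> H) \<longleftrightarrow> finite (f ` G)" "subgroup_index G H = card (f ` G)"
    unfolding rc subgroup_index_def by (auto dest: bij_betw_finite bij_betw_same_card)
qed

lemma sublattice_iff:
  assumes "additive_subgroup G"
  shows "sublattice H G \<longleftrightarrow> H \<subseteq> G \<and> additive_subgroup H \<and> finite (rcosets\<^bsub>additive_group G\<^esub> H)"
  by (auto simp: sublattice_def subgroup_additive_group_iff[OF assms])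

text \<open>The tower law. With a fixed representative in each coset of \<open>H\<close>, the pair
  consisting of the \<open>H\<close>-coset of x and the \<open>K\<close>-coset of x minus its
  representative separates points exactly modulo \<open>K\<close>, and its image is the full
  product.\<close>

lemma
  assumes G: "additive_subgroup G" and HG: "sublattice H G" and KH: "sublattice K H"
  shows sublattice_trans: "sublattice K G"
    and subgroup_index_mult: "subgroup_index G K = subgroup_index G H * subgroup_index H K"
proof -
  have H: "additive_subgroup H" "H \<subseteq> G" and finH: "finite (rcosets\<^bsub>additive_group G\<^esub> H)"
    using HG by (auto simp: sublattice_iff[OF G])
  then have K: "additive_subgroup K" "K \<subseteq> H" and finK: "finite (rcosets\<^bsub>additive_group H\<^esub> K)"
    using KH by (auto simp: sublattice_iff)
  define c where "c x = (\<lambda>h. h + x) ` H" for x :: "real^2"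
  have c: "c x = c y \<longleftrightarrow> x - y \<in> H" for x y unfolding c_def by (rule coset_eq_iff[OF H(1)])
  define d where "d x = (\<lambda>h. h + x) ` K" for x :: "real^2"
  have d: "d x = d y \<longleftrightarrow> x - y \<in> K" for x y unfolding d_def by (rule coset_eq_iff[OF K(1)])
  define rep where "rep C = (SOME x. x \<in> G \<and> c x = C)" for C
  have rep: "rep (c x) \<in> G" "c (rep (c x)) = c x" if "x \<in> G" for x
    using someI[of "\<lambda>y. y \<in> G \<and> c y = c x" x] that unfolding rep_def by auto
  define f where "f x = (c x, d (x - rep (c x)))" for x
  have f: "f x = f y \<longleftrightarrow> x - y \<in> K" for x y
  proof (cases "c x = c y")
    case True
    then have "f x = f y \<longleftrightarrow> d (x - rep (c y)) = d (y - rep (c y))" by (simp add: f_def)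
    then show ?thesis by (simp add: d)
  next
    case False
    then have "x - y \<notin> K" using c[of x y] K(2) by blast
    then show ?thesis using False by (simp add: f_def)
  qed
  have im: "f ` G = (c ` G) \<times> (d ` H)"
  proof (intro equalityI subsetI)
    fix p assume "p \<in> f ` G"
    then obtain x where x: "x \<in> G" "p = f x" by auto
    then have "x - rep (c x) \<in> H" using rep(2)[OF x(1)] c[of x "rep (c x)"] by simp
    then show "p \<in> (c ` G) \<times> (d ` H)" using x by (auto simp: f_def)
  next
    fix p assume "p \<in> (c ` G) \<times> (d ` H)"
    then obtain g h where g: "g \<in> G" and h: "h \<in> H" and p: "p = (c g, d h)" by auto
    have "c (rep (c g) + h) = c (rep (c g))" using h c[of "rep (c g) + h" "rep (c g)"] by simp
    then have "f (rep (c g) + h) = p" using rep[OF g] by (simp add: f_def p)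
    moreover have "rep (c g) + h \<in> G" using rep[OF g] h H(2) additive_subgroup_add[OF G] by blast
    ultimately show "p \<in> f ` G" by blast
  qed
  have "finite (c ` G)" "subgroup_index G H = card (c ` G)"
    using finite_rcosets_iff[OF H(1) c, of G] subgroup_index_eq_card[OF H(1) c, of G] finH by auto
  moreover have "finite (d ` H)" "subgroup_index H K = card (d ` H)"
    using finite_rcosets_iff[OF K(1) d, of H] subgroup_index_eq_card[OF K(1) d, of H] finK by auto
  moreover have "finite (rcosets\<^bsub>additive_group G\<^esub> K) \<longleftrightarrow> finite (f ` G)" "subgroup_index G K = card (f ` G)"
    using finite_rcosets_iff[OF K(1) f, of G] subgroup_index_eq_card[OF K(1) f, of G] by auto
  ultimately show "sublattice K G" "subgroup_index G K = subgroup_index G H * subgroup_index H K"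
    unfolding sublattice_iff[OF G] im card_cartesian_product using K H by auto
qed

lemma subgroup_index_pos:
  assumes "additive_subgroup G" "sublattice H G"
  shows "subgroup_index G H > 0"
proof -
  have "finite (rcosets\<^bsub>additive_group G\<^esub> H)" using assms by (simp add: sublattice_def)
  moreover have "rcosets\<^bsub>additive_group G\<^esub> H \<noteq> {}"
    using additive_subgroup_zero[OF assms(1)] by (auto simp: RCOSETS_def additive_group_def)
  ultimately show ?thesis by (simp add: subgroup_index_def card_gt_0_iff)
qed

text \<open>Pigeonhole: the multiples of x fall into finitely many cosets, so two of them differ by
  an element of \<open>H\<close>.\<close>

lemma sublattice_multiple:
  assumes "additive_subgroup G" "sublattice H G" "x \<in> G"
  obtains k :: nat where "k > 0" "real k *\<^sub>R x \<in> H"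
proof -
  have H: "additive_subgroup H" and fin: "finite (rcosets\<^bsub>additive_group G\<^esub> H)"
    using assms by (auto simp: sublattice_iff)
  define c where "c x = (\<lambda>h. h + x) ` H" for x :: "real^2"
  have c: "c x = c y \<longleftrightarrow> x - y \<in> H" for x y unfolding c_def by (rule coset_eq_iff[OF H])
  have "finite (c ` G)" using finite_rcosets_iff[OF H c, of G] fin by auto
  moreover have "range (\<lambda>k::nat. c (real k *\<^sub>R x)) \<subseteq> c ` G"
  proof (intro image_subsetI imageI)
    show "real k *\<^sub>R x \<in> G" for k :: nat
      using additive_subgroup_scale[OF assms(1,3), of "int k"] by simp
  qed
  ultimately have "\<not> inj (\<lambda>k::nat. c (real k *\<^sub>R x))"
    using finite_subset[of "range (\<lambda>k::nat. c (real k *\<^sub>R x))"] range_inj_infinite[of "\<lambda>k::nat. c (real k *\<^sub>R x)"] by blast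
  then obtain i j :: nat where ij: "c (real i *\<^sub>R x) = c (real j *\<^sub>R x)" "i < j"
    using linorder_injI[of "\<lambda>k::nat. c (real k *\<^sub>R x)"] by blast
  then have "real j *\<^sub>R x - real i *\<^sub>R x \<in> H" using c[of "real j *\<^sub>R x" "real i *\<^sub>R x"] by simp
  then show thesis using ij(2) by (intro that[of "j - i"]) (auto simp: of_nat_diff scaleR_left_diff_distrib)
qed

lemma sublattice_common_multiple:
  assumes "sublattice H (int_span e1 e2)"
  obtains N :: nat where "N > 0" "\<And>x. x \<in> int_span e1 e2 \<Longrightarrow> real N *\<^sub>R x \<in> H"
proof -
  note G = additive_subgroup_int_span[of e1 e2]
  have H: "additive_subgroup H" using assms by (auto simp: sublattice_iff[OF G])
  obtain k :: nat where k: "k > 0" "real k *\<^sub>R e1 \<in> H"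
    by (rule sublattice_multiple[OF G assms int_span_gens(1)])
  obtain l :: nat where l: "l > 0" "real l *\<^sub>R e2 \<in> H"
    by (rule sublattice_multiple[OF G assms int_span_gens(2)])
  have "real (k * l) *\<^sub>R x \<in> H" if x: "x \<in> int_span e1 e2" for x
  proof -
    obtain m n :: int where "x = of_int m *\<^sub>R e1 + of_int n *\<^sub>R e2"
      using x by (rule int_spanE)
    then have "real (k * l) *\<^sub>R x = of_int (m * int l) *\<^sub>R (real k *\<^sub>R e1) + of_int (n * int k) *\<^sub>R (real l *\<^sub>R e2)"
      by (simp add: scaleR_right_distrib mult_ac)
    also have "\<dots> \<in> H" using k l H by (intro additive_subgroup_add additive_subgroup_scale)
    finally show ?thesis .
  qed
  then show thesis using that[of "k * l"] k l by auto
qed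

text \<open>Reducing both coordinates modulo N changes a vector by an element of \<open>H\<close>,
  so at most N^2 cosets occur. Only finiteness is at stake; representatives may repeat.\<close>

lemma sublattice_of_multiple:
  assumes "additive_subgroup H" "H \<subseteq> int_span e1 e2" "N > 0"
    and "real N *\<^sub>R e1 \<in> H" "real N *\<^sub>R e2 \<in> H"
  shows "sublattice H (int_span e1 e2)"
proof -
  define c where "c x = (\<lambda>h. h + x) ` H" for x :: "real^2"
  have c: "c x = c y \<longleftrightarrow> x - y \<in> H" for x y unfolding c_def by (rule coset_eq_iff[OF assms(1)])
  have "c ` int_span e1 e2 \<subseteq> (\<lambda>(i, j). c (of_int i *\<^sub>R e1 + of_int j *\<^sub>R e2)) ` ({0..<int N} \<times> {0..<int N})"
  proof
    fix C assume "C \<in> c ` int_span e1 e2"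
    then obtain m n :: int where C: "C = c (of_int m *\<^sub>R e1 + of_int n *\<^sub>R e2)"
      by (auto simp: int_span_def)
    have mod: "real_of_int m = of_int (m mod int N) + of_int (m div int N) * real N" for m
    proof -
      have "real_of_int m = of_int (m mod int N + m div int N * int N)" by simp
      then show ?thesis by (simp only: of_int_add of_int_mult of_int_of_nat_eq)
    qed
    have "(of_int m *\<^sub>R e1 + of_int n *\<^sub>R e2) - (of_int (m mod int N) *\<^sub>R e1 + of_int (n mod int N) *\<^sub>R e2)
        = of_int (m div int N) *\<^sub>R (real N *\<^sub>R e1) + of_int (n div int N) *\<^sub>R (real N *\<^sub>R e2)"
      unfolding mod[of m] mod[of n] by (simp add: algebra_simps)
    also have "\<dots> \<in> H"
      using assms by (intro additive_subgroup_add additive_subgroup_scale) auto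
    finally have "C = c (of_int (m mod int N) *\<^sub>R e1 + of_int (n mod int N) *\<^sub>R e2)" unfolding C c .
    then show "C \<in> (\<lambda>(i, j). c (of_int i *\<^sub>R e1 + of_int j *\<^sub>R e2)) ` ({0..<int N} \<times> {0..<int N})"
      using assms(3) by (intro image_eqI[of _ _ "(m mod int N, n mod int N)"]) auto
  qed
  then have "finite (c ` int_span e1 e2)" using finite_subset by blast
  then show ?thesis
    using assms finite_rcosets_iff[OF assms(1) c, of "int_span e1 e2"]
    by (auto simp: sublattice_iff additive_subgroup_int_span)
qed

section \<open>Coordinates and the index of a sublattice with a triangular basis\<close>

text \<open>Independence of the pair, not of the set: for u = v the set \<open>{u, v}\<close>
  collapses to a singleton and can still be independent.\<close>

definition coords_unique :: "real^2 \<Rightarrow> real^2 \<Rightarrow> bool" where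
  "coords_unique u v \<longleftrightarrow> (\<forall>a b. a *\<^sub>R u + b *\<^sub>R v = 0 \<longrightarrow> a = 0 \<and> b = 0)"

lemma coords_unique_eq:
  assumes "coords_unique u v" "a *\<^sub>R u + b *\<^sub>R v = c *\<^sub>R u + d *\<^sub>R v"
  shows "a = c" "b = d"
proof -
  have "(a - c) *\<^sub>R u + (b - d) *\<^sub>R v = 0" using assms(2) by (simp add: algebra_simps)
  then show "a = c" "b = d" using assms(1) unfolding coords_unique_def by force+
qed

text \<open>Hermite normal form. Subtracting y div d copies of the second generator brings the
  second coordinate into \<open>{0..<d}\<close>; multiples of the first generator then bring the
  first coordinate into \<open>{0..<a}\<close>. This leaves exactly a d classes.\<close>

lemma
  fixes a d b :: int
  assumes uv: "coords_unique u v" and "a > 0" "d > 0"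
  defines "H \<equiv> int_span (of_int a *\<^sub>R u) (of_int b *\<^sub>R u + of_int d *\<^sub>R v)"
  shows sublattice_hermite: "sublattice H (int_span u v)"
    and subgroup_index_hermite: "subgroup_index (int_span u v) H = nat (a * d)"
proof -
  define p where "p x y = of_int x *\<^sub>R u + of_int y *\<^sub>R v" for x y :: int
  have p_eq: "p x y = p x' y' \<longleftrightarrow> x = x' \<and> y = y'" for x y x' y'
    using coords_unique_eq[OF uv] unfolding p_def by (metis of_int_eq_iff)
  have G: "int_span u v = range (\<lambda>(x, y). p x y)" by (auto simp: int_span_def p_def)
  have pH: "p x y \<in> H \<longleftrightarrow> (\<exists>s t. x = s * a + t * b \<and> y = t * d)" for x y
  proof -
    have "p x y \<in> H \<longleftrightarrow> (\<exists>s t. p x y = p (s * a + t * b) (t * d))"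
      unfolding H_def int_span_def p_def by (simp add: algebra_simps)
    then show ?thesis by (simp add: p_eq)
  qed
  define g where "g x y = ((x - b * (y div d)) mod a, y mod d)" for x y :: int
  have g: "g x y = g x' y' \<longleftrightarrow> p x y - p x' y' \<in> H" for x y x' y'
  proof -
    have "p x y - p x' y' = p (x - x') (y - y')" by (simp add: p_def algebra_simps)
    then have "p x y - p x' y' \<in> H \<longleftrightarrow> (\<exists>s t. x - x' = s * a + t * b \<and> y - y' = t * d)"
      using pH by metis
    also have "\<dots> \<longleftrightarrow> g x y = g x' y'"
    proof
      assume "\<exists>s t. x - x' = s * a + t * b \<and> y - y' = t * d"
      then obtain s t where st: "x = x' + (s * a + t * b)" "y = y' + t * d" by (auto simp: algebra_simps)
      have "y mod d = y' mod d" "y div d = y' div d + t" using assms(3) st by auto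
      moreover have "x - b * (y' div d + t) = x' - b * (y' div d) + s * a" using st by (simp add: algebra_simps)
      ultimately show "g x y = g x' y'" by (simp add: g_def)
    next
      assume eq: "g x y = g x' y'"
      define t where "t = y div d - y' div d"
      have "y mod d = y' mod d" using eq by (simp add: g_def)
      moreover have "y = y div d * d + y mod d" "y' = y' div d * d + y' mod d" by simp_all
      ultimately have "y - y' = t * d" unfolding t_def left_diff_distrib by linarith
      moreover obtain s where "x - b * (y div d) - (x' - b * (y' div d)) = a * s"
        using eq unfolding g_def by (auto simp: mod_eq_dvd_iff elim: dvdE)
      then have "x - x' = s * a + t * b" by (simp add: t_def algebra_simps)
      ultimately show "\<exists>s t. x - x' = s * a + t * b \<and> y - y' = t * d" by blast
    qed
    finally show ?thesis by simp
  qed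
  \<comment> \<open>The invariant \<open>g\<close> is defined on coordinates; \<open>f\<close>
    transports it to vectors, and \<open>SOME\<close> recovers the coordinates because they are
    unique.\<close>
  define f where "f z = (case (SOME q. z = (\<lambda>(x, y). p x y) q) of (x, y) \<Rightarrow> g x y)" for z
  have fp: "f (p x y) = g x y" for x y
  proof -
    have "(SOME q. p x y = (\<lambda>(x, y). p x y) q) = (x, y)"
      by (rule some_equality) (auto simp: p_eq)
    then show ?thesis by (simp add: f_def)
  qed
  have f: "f x = f y \<longleftrightarrow> x - y \<in> H" if "x \<in> int_span u v" "y \<in> int_span u v" for x y
    using that g unfolding G by (auto simp: fp)
  have "f ` int_span u v = {0..<a} \<times> {0..<d}"
  proof (intro equalityI subsetI)
    fix z assume "z \<in> f ` int_span u v"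
    then show "z \<in> {0..<a} \<times> {0..<d}" using assms unfolding G by (auto simp: fp g_def)
  next
    fix z assume "z \<in> {0..<a} \<times> {0..<d}"
    then obtain x y where xy: "z = (x, y)" "0 \<le> x" "x < a" "0 \<le> y" "y < d" by auto
    then have "f (p x y) = z" by (simp add: fp g_def)
    then show "z \<in> f ` int_span u v" unfolding G by auto
  qed
  then have "finite (f ` int_span u v)" "card (f ` int_span u v) = nat (a * d)"
    using assms by (auto simp: card_cartesian_product nat_mult_distrib)
  moreover have H: "additive_subgroup H" unfolding H_def by (rule additive_subgroup_int_span)
  moreover have "H \<subseteq> int_span u v" unfolding H_def
    using int_spanI[of a u 0 v] int_spanI[of b u d v]
    by (intro int_span_subset additive_subgroup_int_span) auto
  ultimately show "sublattice H (int_span u v)" "subgroup_index (int_span u v) H = nat (a * d)"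
    using finite_rcosets_iff[OF H f] subgroup_index_eq_card[OF H f]
    by (auto simp: sublattice_iff additive_subgroup_int_span)
qed

section \<open>Orthogonal axes and coincidence reflections\<close>

lemma coords_unique_iff_independent:
  "coords_unique u v \<longleftrightarrow> u \<noteq> v \<and> independent {u, v}"
proof
  assume uv: "coords_unique u v"
  have "u \<noteq> v" using uv[unfolded coords_unique_def, rule_format, of 1 "- 1"] by auto
  moreover have "v \<noteq> 0" using uv[unfolded coords_unique_def, rule_format, of 0 1] by auto
  moreover have "u \<notin> span {v}"
  proof
    assume "u \<in> span {v}"
    then obtain k where "u = k *\<^sub>R v" by (auto simp: span_singleton)
    then show False using uv[unfolded coords_unique_def, rule_format, of 1 "- k"] by auto
  qed
  ultimately show "u \<noteq> v \<and> independent {u, v}" by (simp add: independent_insert)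
next
  assume "u \<noteq> v \<and> independent {u, v}"
  then have u: "u \<notin> span {v}" and v: "v \<noteq> 0" by (auto simp: independent_insert)
  show "coords_unique u v" unfolding coords_unique_def
  proof (intro allI impI)
    fix a b assume ab: "a *\<^sub>R u + b *\<^sub>R v = 0"
    have "a = 0"
    proof (rule ccontr)
      assume a: "a \<noteq> 0"
      have "a *\<^sub>R u = (- b) *\<^sub>R v" using ab by (simp add: add_eq_0_iff2)
      then have "u = ((- b) / a) *\<^sub>R v" using a by (metis divideR_right scaleR_scaleR inverse_eq_divide mult.commute times_divide_eq_right mult_1_right)
      moreover have "((- b) / a) *\<^sub>R v \<in> span {v}" by (intro span_scale span_base) simp
      ultimately show False using u by simp
    qed
    with ab v show "a = 0 \<and> b = 0" by simp
  qed
qed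

lemma lattice_basis_iff:
  "lattice_basis u v \<Gamma> \<longleftrightarrow> coords_unique u v \<and> \<Gamma> = int_span u v"
  by (auto simp: lattice_basis_def coords_unique_iff_independent int_span_def)

lemma coords_exist:
  fixes u v x :: "real^2"
  assumes "coords_unique u v"
  obtains s t where "x = s *\<^sub>R u + t *\<^sub>R v"
proof -
  have "u \<noteq> v" "independent {u, v}" using assms by (auto simp: coords_unique_iff_independent)
  then have "UNIV \<subseteq> span {u, v}" by (intro card_ge_dim_independent) auto
  then have "x \<in> span {u, v}" by blast
  then obtain s where "x - s *\<^sub>R u \<in> span {v}" by (auto simp: span_insert)
  then obtain t where "x - s *\<^sub>R u = t *\<^sub>R v" by (auto simp: span_singleton)
  then have "x = s *\<^sub>R u + t *\<^sub>R v" by (simp add: algebra_simps)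
  then show thesis by (rule that)
qed

definition orthogonal_pair :: "real^2 \<Rightarrow> real^2 \<Rightarrow> bool" where
  "orthogonal_pair u w \<longleftrightarrow> u \<noteq> 0 \<and> w \<noteq> 0 \<and> u \<bullet> w = 0"

lemma orthogonal_pair_sym: "orthogonal_pair u w \<Longrightarrow> orthogonal_pair w u"
  by (auto simp: orthogonal_pair_def inner_commute)

lemma orthogonal_pair_coords_unique:
  assumes "orthogonal_pair u w"
  shows "coords_unique u w"
  unfolding coords_unique_def
proof (intro allI impI)
  fix a b assume ab: "a *\<^sub>R u + b *\<^sub>R w = 0"
  have "a * (u \<bullet> u) = (a *\<^sub>R u + b *\<^sub>R w) \<bullet> u" "b * (w \<bullet> w) = (a *\<^sub>R u + b *\<^sub>R w) \<bullet> w"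
    using assms by (auto simp: orthogonal_pair_def inner_add_left inner_commute[of w u])
  then show "a = 0 \<and> b = 0" using assms unfolding ab by (auto simp: orthogonal_pair_def)
qed

lemma orthogonal_pair_inner:
  assumes "orthogonal_pair u w"
  shows "(a *\<^sub>R u + b *\<^sub>R w) \<bullet> (c *\<^sub>R u + d *\<^sub>R w) = a * c * (u \<bullet> u) + b * d * (w \<bullet> w)"
  using assms by (simp add: orthogonal_pair_def inner_add_left inner_add_right inner_commute)

text \<open>Cramer's rule: the determinant D of the coordinates of u and w satisfies D e1 = s u - q
  w and D e2 = p w - r u. If D were 0, independence of u and w would kill all four coordinates and
  hence u.\<close>

lemma int_span_multiple:
  assumes "coords_unique u w" "u \<in> int_span e1 e2" "w \<in> int_span e1 e2"
  obtains N :: nat where "N > 0" "\<And>x. x \<in> int_span e1 e2 \<Longrightarrow> real N *\<^sub>R x \<in> int_span u w"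
proof -
  obtain p q :: int where u: "u = of_int p *\<^sub>R e1 + of_int q *\<^sub>R e2" using assms(2) by (rule int_spanE)
  obtain r s :: int where w: "w = of_int r *\<^sub>R e1 + of_int s *\<^sub>R e2" using assms(3) by (rule int_spanE)
  define D where "D = p * s - q * r"
  have 1: "of_int D *\<^sub>R e1 = of_int s *\<^sub>R u + of_int (- q) *\<^sub>R w"
    and 2: "of_int D *\<^sub>R e2 = of_int (- r) *\<^sub>R u + of_int p *\<^sub>R w"
    unfolding u w D_def by (simp_all add: algebra_simps)
  have "D \<noteq> 0"
  proof
    assume "D = 0"
    then have "s = 0" "q = 0" "r = 0" "p = 0" 
      using 1 2 assms(1) unfolding coords_unique_def by (metis of_int_0 of_int_eq_0_iff scaleR_zero_left neg_equal_0_iff_equal)+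
    then show False using u assms(1)[unfolded coords_unique_def, rule_format, of 1 0] by simp
  qed
  have "real (nat \<bar>D\<bar>) *\<^sub>R x \<in> int_span u w" if x: "x \<in> int_span e1 e2" for x
  proof -
    obtain m n :: int where x: "x = of_int m *\<^sub>R e1 + of_int n *\<^sub>R e2" using x by (rule int_spanE)
    have "of_int D *\<^sub>R x = of_int m *\<^sub>R (of_int D *\<^sub>R e1) + of_int n *\<^sub>R (of_int D *\<^sub>R e2)"
      unfolding x by (simp add: algebra_simps)
    also have "\<dots> = of_int m *\<^sub>R (of_int s *\<^sub>R u + of_int (- q) *\<^sub>R w) + of_int n *\<^sub>R (of_int (- r) *\<^sub>R u + of_int p *\<^sub>R w)"
      unfolding 1 2 ..
    also have "\<dots> \<in> int_span u w"
      by (intro additive_subgroup_add additive_subgroup_scale additive_subgroup_int_span int_spanI)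
    \<comment> \<open>The factor sgn D replaces D by its absolute value, since N is a natural
      number.\<close>
    finally have "of_int (sgn D) *\<^sub>R (of_int D *\<^sub>R x) \<in> int_span u w"
      by (rule additive_subgroup_scale[OF additive_subgroup_int_span])
    moreover have "real_of_int (sgn D) * of_int D = real (nat \<bar>D\<bar>)" by (simp add: sgn_if)
    ultimately show ?thesis by (simp only: scaleR_scaleR)
  qed
  then show thesis using that[of "nat \<bar>D\<bar>"] \<open>D \<noteq> 0\<close> by simp
qed

lemma sublattice_int_span:
  assumes "coords_unique u w" "u \<in> int_span e1 e2" "w \<in> int_span e1 e2"
    and "additive_subgroup H" "u \<in> H" "w \<in> H" "H \<subseteq> int_span e1 e2"
  shows "sublattice H (int_span e1 e2)"
proof -
  obtain N :: nat where N: "N > 0" "\<And>x. x \<in> int_span e1 e2 \<Longrightarrow> real N *\<^sub>R x \<in> int_span u w"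
    using int_span_multiple[OF assms(1-3)] by blast
  then show ?thesis
    using int_span_subset[OF assms(4-6)] assms(4,7) int_span_gens by (intro sublattice_of_multiple[of H _ _ N]) auto
qed

text \<open>Lattice vectors have rational coordinates with respect to u and w. After scaling by 1 /
  |w|, the inner product of two of them is a c (|u|^2 / |w|^2) + b d with rational a, b, c, d, so
  the Gram matrix becomes rational.\<close>

lemma rational_lattice_if_axis_ratio:
  assumes e: "coords_unique e1 e2"
    and uw: "orthogonal_pair u w" "u \<in> int_span e1 e2" "w \<in> int_span e1 e2"
    and ratio: "(u \<bullet> u) / (w \<bullet> w) \<in> \<rat>"
  shows "rational_lattice (int_span e1 e2)"
proof -
  obtain N :: nat where N: "N > 0" "\<And>x. x \<in> int_span e1 e2 \<Longrightarrow> real N *\<^sub>R x \<in> int_span u w"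
    using int_span_multiple[OF orthogonal_pair_coords_unique[OF uw(1)] uw(2,3)] by blast
  have rat: "\<exists>s t. s \<in> \<rat> \<and> t \<in> \<rat> \<and> x = s *\<^sub>R u + t *\<^sub>R w" if x: "x \<in> int_span e1 e2" for x
  proof -
    obtain m n :: int where mn: "real N *\<^sub>R x = of_int m *\<^sub>R u + of_int n *\<^sub>R w"
      using N(2)[OF x] by (rule int_spanE)
    have "x = (1 / real N) *\<^sub>R (real N *\<^sub>R x)" using N(1) by simp
    also have "\<dots> = (of_int m / real N) *\<^sub>R u + (of_int n / real N) *\<^sub>R w"
      unfolding mn by (simp add: scaleR_right_distrib)
    finally show ?thesis by (intro exI[of _ "of_int m / real N"] exI[of _ "of_int n / real N"]) auto
  qed
  have inner: "((1 / norm w) *\<^sub>R x) \<bullet> ((1 / norm w) *\<^sub>R y) \<in> \<rat>"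
    if x: "x \<in> int_span e1 e2" and y: "y \<in> int_span e1 e2" for x y
  proof -
    obtain a b where ab: "a \<in> \<rat>" "b \<in> \<rat>" "x = a *\<^sub>R u + b *\<^sub>R w" using rat[OF x] by blast
    obtain c d where cd: "c \<in> \<rat>" "d \<in> \<rat>" "y = c *\<^sub>R u + d *\<^sub>R w" using rat[OF y] by blast
    have w: "w \<bullet> w \<noteq> 0" using uw(1) by (simp add: orthogonal_pair_def)
    have "((1 / norm w) *\<^sub>R x) \<bullet> ((1 / norm w) *\<^sub>R y) = (x \<bullet> y) / (w \<bullet> w)"
      by (simp add: norm_eq_sqrt_inner)
    also have "\<dots> = a * c * ((u \<bullet> u) / (w \<bullet> w)) + b * d"
      unfolding ab(3) cd(3) orthogonal_pair_inner[OF uw(1)] using w by (simp add: field_simps)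
    also have "\<dots> \<in> \<rat>" using ab cd ratio by (intro Rats_add Rats_mult)
    finally show ?thesis .
  qed
  define c where "c = 1 / norm w"
  have c: "c > 0" using uw(1) by (simp add: c_def orthogonal_pair_def)
  have "similar_lattices (int_span e1 e2) ((\<lambda>x. c *\<^sub>R id x) ` int_span e1 e2)"
    unfolding similar_lattices_def using c orthogonal_transformation_id
    by (intro exI[of _ c] exI[of _ id] conjI refl) (simp_all only: id_def)
  moreover have "(\<lambda>x. c *\<^sub>R id x) ` int_span e1 e2 = int_span (c *\<^sub>R e1) (c *\<^sub>R e2)"
  proof -
    have eq: "c *\<^sub>R id (of_int m *\<^sub>R e1 + of_int n *\<^sub>R e2) = of_int m *\<^sub>R (c *\<^sub>R e1) + of_int n *\<^sub>R (c *\<^sub>R e2)"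
      for m n :: int by (simp add: scaleR_right_distrib mult.commute)
    show ?thesis
    proof (intro equalityI image_subsetI subsetI)
      fix x assume "x \<in> int_span e1 e2"
      then obtain m n :: int where x: "x = of_int m *\<^sub>R e1 + of_int n *\<^sub>R e2" by (rule int_spanE)
      show "c *\<^sub>R id x \<in> int_span (c *\<^sub>R e1) (c *\<^sub>R e2)" unfolding x eq by (rule int_spanI)
    next
      fix x assume "x \<in> int_span (c *\<^sub>R e1) (c *\<^sub>R e2)"
      then obtain m n :: int where x: "x = of_int m *\<^sub>R (c *\<^sub>R e1) + of_int n *\<^sub>R (c *\<^sub>R e2)" by (rule int_spanE)
      show "x \<in> (\<lambda>x. c *\<^sub>R id x) ` int_span e1 e2" unfolding x eq[symmetric] by (intro imageI int_spanI)
    qed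
  qed
  moreover have "coords_unique (c *\<^sub>R e1) (c *\<^sub>R e2)"
    unfolding coords_unique_def
  proof (intro allI impI)
    fix a b assume "a *\<^sub>R c *\<^sub>R e1 + b *\<^sub>R c *\<^sub>R e2 = 0"
    then have "(a * c) *\<^sub>R e1 + (b * c) *\<^sub>R e2 = 0" by simp
    then have "a * c = 0 \<and> b * c = 0" using e unfolding coords_unique_def by blast
    then show "a = 0 \<and> b = 0" using c by simp
  qed
  moreover have "\<forall>i j. gram_matrix (c *\<^sub>R e1) (c *\<^sub>R e2) $ i $ j \<in> \<rat>"
    unfolding gram_matrix_def forall_2 vector_2 c_def by (intro conjI inner int_span_gens)
  ultimately show ?thesis
    unfolding rational_lattice_def has_rational_gram_matrix_def lattice_basis_iff by metis
qed

text \<open>Here irrationality is used. In coordinates with respect to u, w the orthogonality of u',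
  w' is a linear relation between |u|^2 and |w|^2 with integer coefficients a c and b d. Both must
  vanish, and as u' and w' are non-zero, each of them lies on its own axis.\<close>

lemma orthogonal_pairs_parallel:
  assumes e: "coords_unique e1 e2" and nr: "\<not> rational_lattice (int_span e1 e2)"
    and uw: "orthogonal_pair u w" "u \<in> int_span e1 e2" "w \<in> int_span e1 e2"
    and uw': "orthogonal_pair u' w'" "u' \<in> int_span e1 e2" "w' \<in> int_span e1 e2"
  shows "(\<exists>k l. u' = k *\<^sub>R u \<and> w' = l *\<^sub>R w) \<or> (\<exists>k l. u' = k *\<^sub>R w \<and> w' = l *\<^sub>R u)"
proof -
  obtain N :: nat where N: "N > 0" "\<And>x. x \<in> int_span e1 e2 \<Longrightarrow> real N *\<^sub>R x \<in> int_span u w"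
    using int_span_multiple[OF orthogonal_pair_coords_unique[OF uw(1)] uw(2,3)] by blast
  obtain a b :: int where ab: "real N *\<^sub>R u' = of_int a *\<^sub>R u + of_int b *\<^sub>R w"
    using N(2)[OF uw'(2)] by (rule int_spanE)
  obtain c d :: int where cd: "real N *\<^sub>R w' = of_int c *\<^sub>R u + of_int d *\<^sub>R w"
    using N(2)[OF uw'(3)] by (rule int_spanE)
  have u': "u' = (of_int a / N) *\<^sub>R u + (of_int b / N) *\<^sub>R w"
  proof -
    have "u' = (1 / real N) *\<^sub>R (real N *\<^sub>R u')" using N(1) by simp
    then show ?thesis unfolding ab by (simp add: scaleR_right_distrib)
  qed
  have w': "w' = (of_int c / N) *\<^sub>R u + (of_int d / N) *\<^sub>R w"
  proof -
    have "w' = (1 / real N) *\<^sub>R (real N *\<^sub>R w')" using N(1) by simp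
    then show ?thesis unfolding cd by (simp add: scaleR_right_distrib)
  qed
  have pos: "u \<bullet> u > 0" "w \<bullet> w > 0" using uw(1) by (auto simp: orthogonal_pair_def)
  have "(real N *\<^sub>R u') \<bullet> (real N *\<^sub>R w') = 0" using uw'(1) by (simp add: orthogonal_pair_def)
  then have 0: "a * c * (u \<bullet> u) + b * d * (w \<bullet> w) = 0"
    unfolding ab cd orthogonal_pair_inner[OF uw(1)] by simp
  have nz: "\<not> (a = 0 \<and> b = 0)" "\<not> (c = 0 \<and> d = 0)" using u' w' uw'(1) by (auto simp: orthogonal_pair_def)
  have "a * c = 0"
  proof (rule ccontr)
    assume ac: "a * c \<noteq> 0"
    then have "real_of_int a * real_of_int c \<noteq> 0" by simp
    then have "(u \<bullet> u) / (w \<bullet> w) = - (of_int b * of_int d) / (of_int a * of_int c)"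
      using 0 pos by (simp add: field_simps)
    also have "\<dots> \<in> \<rat>" by simp
    finally show False using rational_lattice_if_axis_ratio[OF e uw] nr by blast
  qed
  with 0 pos have "b * d = 0" by (metis add_0 mult_eq_0_iff of_int_eq_0_iff of_int_mult less_irrefl mult_zero_left)
  with \<open>a * c = 0\<close> nz have "b = 0 \<and> c = 0 \<or> a = 0 \<and> d = 0" by auto
  then show ?thesis
  proof
    assume "b = 0 \<and> c = 0"
    then have "u' = (of_int a / N) *\<^sub>R u" "w' = (of_int d / N) *\<^sub>R w" using u' w' by simp_all
    then show ?thesis by blast
  next
    assume "a = 0 \<and> d = 0"
    then have "u' = (of_int b / N) *\<^sub>R w" "w' = (of_int c / N) *\<^sub>R u" using u' w' by simp_all
    then show ?thesis by blast
  qed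
qed

section \<open>Reflections, and the correspondence of coincidence reflections with orthogonal
  pairs\<close>

text \<open>The vector \<open>v\<close> is the normal of the mirror line: for an orthogonal pair u,
  w the map \<open>line_refl w\<close> fixes u and negates w.\<close>

definition line_refl :: "real^2 \<Rightarrow> real^2 \<Rightarrow> real^2" where
  "line_refl v x = x - (2 * (x \<bullet> v) / (v \<bullet> v)) *\<^sub>R v"

lemma is_reflection_iff: "is_reflection R \<longleftrightarrow> (\<exists>v. v \<noteq> 0 \<and> R = line_refl v)"
  by (simp add: is_reflection_def line_refl_def[abs_def])

lemma linear_line_refl: "linear (line_refl v)"
proof (rule linearI)
  show "line_refl v (x + y) = line_refl v x + line_refl v y" for x y
    by (simp add: line_refl_def inner_add_left distrib_left add_divide_distrib scaleR_left_distrib)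
  show "line_refl v (c *\<^sub>R x) = c *\<^sub>R line_refl v x" for c x
    by (simp add: line_refl_def scaleR_right_diff_distrib mult.left_commute)
qed

lemma line_refl_refl: "line_refl v (line_refl v x) = x"
proof (cases "v = 0")
  case False
  then have "v \<bullet> v \<noteq> 0" by simp
  then have "line_refl v x \<bullet> v = - (x \<bullet> v)" by (simp add: line_refl_def inner_diff_left)
  then show ?thesis unfolding line_refl_def[of v "line_refl v x"] by (simp add: line_refl_def)
qed (simp add: line_refl_def)

lemma line_refl_scale:
  assumes "k \<noteq> 0"
  shows "line_refl (k *\<^sub>R v) = line_refl v"
  using assms by (simp add: line_refl_def[abs_def] fun_eq_iff power2_eq_square field_simps)

lemma line_refl_orthogonal:
  assumes "orthogonal_pair u w"
  shows "line_refl w (s *\<^sub>R u + t *\<^sub>R w) = s *\<^sub>R u - t *\<^sub>R w"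
    and "line_refl u (s *\<^sub>R u + t *\<^sub>R w) = - (s *\<^sub>R u) + t *\<^sub>R w"
  using assms
  by (simp_all add: orthogonal_pair_def line_refl_def inner_add_left inner_commute[of w u] scaleR_2 flip: scaleR_scaleR)

text \<open>The reflections in two perpendicular lines differ by the factor -1; this is why
  coincidence reflections come in pairs R, -R.\<close>

lemma line_refl_orthogonal_neg:
  assumes "orthogonal_pair u w"
  shows "line_refl u = (\<lambda>x. - line_refl w x)"
proof
  fix x
  obtain s t where x: "x = s *\<^sub>R u + t *\<^sub>R w"
    using coords_exist[OF orthogonal_pair_coords_unique[OF assms]] by blast
  show "line_refl u x = - line_refl w x" unfolding x line_refl_orthogonal[OF assms] by simp
qed

lemma line_refl_image_iff: "x \<in> line_refl v ` A \<longleftrightarrow> line_refl v x \<in> A"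
  using line_refl_refl by (metis image_iff)

lemma additive_subgroup_Int_line_refl:
  assumes "additive_subgroup G"
  shows "additive_subgroup (G \<inter> line_refl v ` G)"
  using additive_subgroupD[OF assms]
  by (auto simp: additive_subgroup_def line_refl_image_iff linear_diff[OF linear_line_refl] linear_0[OF linear_line_refl])

lemma line_refl_int_span: "line_refl v ` int_span a b = int_span (line_refl v a) (line_refl v b)"
proof -
  have eq: "line_refl v (of_int m *\<^sub>R a + of_int n *\<^sub>R b) = of_int m *\<^sub>R line_refl v a + of_int n *\<^sub>R line_refl v b" for m n :: int
    by (simp add: linear_add[OF linear_line_refl] linear_scale[OF linear_line_refl])
  show ?thesis
  proof (intro equalityI image_subsetI subsetI)
    fix x assume "x \<in> int_span a b"
    then obtain m n :: int where x: "x = of_int m *\<^sub>R a + of_int n *\<^sub>R b" by (rule int_spanE)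
    show "line_refl v x \<in> int_span (line_refl v a) (line_refl v b)" unfolding x eq by (rule int_spanI)
  next
    fix x assume "x \<in> int_span (line_refl v a) (line_refl v b)"
    then obtain m n :: int where x: "x = of_int m *\<^sub>R line_refl v a + of_int n *\<^sub>R line_refl v b" by (rule int_spanE)
    show "x \<in> line_refl v ` int_span a b" unfolding x eq[symmetric] by (intro imageI int_spanI)
  qed
qed

text \<open>The reflection fixes u and negates w, so both vectors lie in the lattice and in its
  image. The intersection thus has full rank in either.\<close>

lemma coincidence_reflection_of_axes:
  assumes uw: "orthogonal_pair u w" "u \<in> int_span e1 e2" "w \<in> int_span e1 e2"
  shows "line_refl w \<in> coincidence_reflections (int_span e1 e2)"
proof -
  let ?G = "int_span e1 e2"
  let ?H = "?G \<inter> line_refl w ` ?G"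
  have H: "additive_subgroup ?H" by (intro additive_subgroup_Int_line_refl additive_subgroup_int_span)
  have "line_refl w u = u" "line_refl w w = - w"
    using line_refl_orthogonal(1)[OF uw(1), of 1 0] line_refl_orthogonal(1)[OF uw(1), of 0 1] by simp_all
  then have in': "u \<in> line_refl w ` ?G" "w \<in> line_refl w ` ?G"
    using uw additive_subgroup_uminus[OF additive_subgroup_int_span] by (simp_all add: line_refl_image_iff)
  note cu = orthogonal_pair_coords_unique[OF uw(1)]
  have "sublattice ?H ?G" using uw in' H by (intro sublattice_int_span[OF cu]) auto
  moreover have "sublattice ?H (line_refl w ` ?G)"
    unfolding line_refl_int_span using uw in' H unfolding line_refl_int_span by (intro sublattice_int_span[OF cu]) auto
  moreover have "is_reflection (line_refl w)" using uw(1) by (auto simp: is_reflection_iff orthogonal_pair_def)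
  ultimately show ?thesis by (simp add: coincidence_reflections_def)
qed

text \<open>Finite index gives an N such that N x and its reflection both lie in the lattice for
  every lattice vector x. Their sum is orthogonal to v and their difference is parallel to v; a
  generator with non-zero sum and one with non-zero difference supply u and w.\<close>

lemma axes_of_coincidence_reflection:
  assumes e: "coords_unique e1 e2" and v: "v \<noteq> 0"
    and sub: "sublattice (int_span e1 e2 \<inter> line_refl v ` int_span e1 e2) (int_span e1 e2)"
  obtains u w k where "orthogonal_pair u w" "u \<in> int_span e1 e2" "w \<in> int_span e1 e2" "w = k *\<^sub>R v"
proof -
  let ?G = "int_span e1 e2"
  obtain N :: nat where N: "N > 0" "\<And>x. x \<in> ?G \<Longrightarrow> real N *\<^sub>R x \<in> ?G \<inter> line_refl v ` ?G"
    using sublattice_common_multiple[OF sub] by blast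
  have vv: "v \<bullet> v \<noteq> 0" using v by simp
  have perp: "(x + line_refl v x) \<bullet> v = 0" for x
    unfolding line_refl_def inner_add_left inner_diff_left inner_scaleR_left using vv by simp
  have par: "x - line_refl v x = (2 * (x \<bullet> v) / (v \<bullet> v)) *\<^sub>R v" for x
    by (simp add: line_refl_def)
  have both: "real N *\<^sub>R x + line_refl v (real N *\<^sub>R x) \<in> ?G" "real N *\<^sub>R x - line_refl v (real N *\<^sub>R x) \<in> ?G" if "x \<in> ?G" for x
    using N(2)[OF that] additive_subgroup_add[OF additive_subgroup_int_span] additive_subgroup_diff[OF additive_subgroup_int_span]
    by (auto simp: line_refl_image_iff)
  \<comment> \<open>Otherwise both generators, and hence v itself, would be orthogonal to v.\<close>
  have "\<exists>x\<in>{e1, e2}. x \<bullet> v \<noteq> 0"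
  proof (rule ccontr)
    assume *: "\<not> (\<exists>x\<in>{e1, e2}. x \<bullet> v \<noteq> 0)"
    obtain s t where v: "v = s *\<^sub>R e1 + t *\<^sub>R e2" using coords_exist[OF e] by blast
    have "v \<bullet> v = s * (e1 \<bullet> v) + t * (e2 \<bullet> v)" by (subst v) (simp only: inner_add_left inner_scaleR_left)
    then show False using * vv by simp
  qed
  then obtain x where x: "x \<in> ?G" "x \<bullet> v \<noteq> 0" using int_span_gens by blast
  define w where "w = real N *\<^sub>R x - line_refl v (real N *\<^sub>R x)"
  define k where "k = 2 * ((real N *\<^sub>R x) \<bullet> v) / (v \<bullet> v)"
  have w: "w = k *\<^sub>R v" unfolding w_def k_def by (rule par)
  have k: "k \<noteq> 0" using x(2) N(1) vv by (simp add: k_def)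
  \<comment> \<open>Otherwise both generators would be negated by the reflection, hence be multiples
    of v and dependent.\<close>
  have "\<exists>y\<in>{e1, e2}. y + line_refl v y \<noteq> 0"
  proof (rule ccontr)
    assume *: "\<not> (\<exists>y\<in>{e1, e2}. y + line_refl v y \<noteq> 0)"
    have "\<exists>c. y = c *\<^sub>R v" if y: "y \<in> {e1, e2}" for y
    proof -
      have "line_refl v y = - y" using * y by (auto simp: add_eq_0_iff)
      then have "2 *\<^sub>R y = (2 * (y \<bullet> v) / (v \<bullet> v)) *\<^sub>R v" using par[of y] by (simp add: scaleR_2)
      then have "y = (1 / 2) *\<^sub>R ((2 * (y \<bullet> v) / (v \<bullet> v)) *\<^sub>R v)" by (metis scaleR_half_double scaleR_2)
      then show ?thesis by (metis scaleR_scaleR)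
    qed
    then obtain c d where cd: "e1 = c *\<^sub>R v" "e2 = d *\<^sub>R v" by blast
    have "d *\<^sub>R e1 + (- c) *\<^sub>R e2 = 0" unfolding cd by (simp add: mult.commute)
    then have "c = 0" using e unfolding coords_unique_def by fastforce
    then have "1 *\<^sub>R e1 + 0 *\<^sub>R e2 = 0" using cd by simp
    then show False using e unfolding coords_unique_def by fastforce
  qed
  then obtain y where y: "y \<in> ?G" "y + line_refl v y \<noteq> 0" using int_span_gens by blast
  define u where "u = real N *\<^sub>R y + line_refl v (real N *\<^sub>R y)"
  have "u = real N *\<^sub>R (y + line_refl v y)" by (simp add: u_def linear_scale[OF linear_line_refl] scaleR_right_distrib)
  then have "u \<noteq> 0" using y N(1) by simp
  moreover have "u \<bullet> w = 0" unfolding w u_def inner_scaleR_right perp by simp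
  ultimately have "orthogonal_pair u w" using w k v by (simp add: orthogonal_pair_def)
  then show thesis using that[of u w k] w both(1)[OF y(1)] both(2)[OF x(1)] by (simp add: u_def w_def)
qed

text \<open>The normal of any coincidence reflection carries a vector of an orthogonal pair in the
  lattice, hence is parallel to u or w, and a reflection depends only on the direction of its
  normal.\<close>

lemma coincidence_reflections_eq:
  assumes e: "coords_unique e1 e2" and nr: "\<not> rational_lattice (int_span e1 e2)"
    and uw: "orthogonal_pair u w" "u \<in> int_span e1 e2" "w \<in> int_span e1 e2"
  shows "coincidence_reflections (int_span e1 e2) = {line_refl w, \<lambda>x. - line_refl w x}"
proof (intro equalityI subsetI)
  fix R assume "R \<in> {line_refl w, \<lambda>x. - line_refl w x}"
  then have "R = line_refl w \<or> R = line_refl u" using line_refl_orthogonal_neg[OF uw(1)] by auto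
  then show "R \<in> coincidence_reflections (int_span e1 e2)"
    using coincidence_reflection_of_axes[OF uw] coincidence_reflection_of_axes[OF orthogonal_pair_sym[OF uw(1)] uw(3,2)] by auto
next
  fix R assume "R \<in> coincidence_reflections (int_span e1 e2)"
  then obtain v where v: "v \<noteq> 0" "R = line_refl v"
    and sub: "sublattice (int_span e1 e2 \<inter> line_refl v ` int_span e1 e2) (int_span e1 e2)"
    by (auto simp: coincidence_reflections_def is_reflection_iff)
  obtain u' w' k where uw': "orthogonal_pair u' w'" "u' \<in> int_span e1 e2" "w' \<in> int_span e1 e2"
    and w': "w' = k *\<^sub>R v"
    using axes_of_coincidence_reflection[OF e v(1) sub] by blast
  have "R = line_refl w'" unfolding v(2) w' using uw'(1) w' by (subst line_refl_scale) (auto simp: orthogonal_pair_def)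
  moreover have "(\<exists>l. w' = l *\<^sub>R w) \<or> (\<exists>l. w' = l *\<^sub>R u)"
    using orthogonal_pairs_parallel[OF e nr uw uw'] by blast
  moreover have "line_refl (l *\<^sub>R x) = line_refl x" if "w' = l *\<^sub>R x" for l x
    using uw'(1) that by (intro line_refl_scale) (auto simp: orthogonal_pair_def)
  ultimately have "R = line_refl w \<or> R = line_refl u" by metis
  then show "R \<in> {line_refl w, \<lambda>x. - line_refl w x}" using line_refl_orthogonal_neg[OF uw(1)] by auto
qed

section \<open>Primitive vectors on the axes and the shape of the reflected part\<close>

text \<open>Divide the coordinates of u by their gcd. If t p' and t q' are integers, Bezout
  coefficients of the coprime p', q' express t as an integer combination of them.\<close>

lemma primitive_vector_exists:
  assumes e: "coords_unique e1 e2" and u: "u \<in> int_span e1 e2" "u \<noteq> 0"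
  obtains u0 k where "u0 \<in> int_span e1 e2" "u0 \<noteq> 0" "u = k *\<^sub>R u0" "\<And>t. t *\<^sub>R u0 \<in> int_span e1 e2 \<Longrightarrow> t \<in> \<int>"
proof -
  obtain p q :: int where pq: "u = of_int p *\<^sub>R e1 + of_int q *\<^sub>R e2" using u(1) by (rule int_spanE)
  define g where "g = gcd p q"
  have g: "g \<noteq> 0" using u(2) pq by (auto simp: g_def)
  obtain p' q' where p': "p = g * p'" and q': "q = g * q'" unfolding g_def by (meson gcd_dvd1 gcd_dvd2 dvdE)
  have "coprime p' q'" using g p' q' unfolding g_def
    by (metis div_gcd_coprime gcd_eq_0_iff nonzero_mult_div_cancel_left)
  then obtain a b where ab: "a * p' + b * q' = 1" by (metis bezout_int coprime_imp_gcd_eq_1)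
  define u0 where "u0 = of_int p' *\<^sub>R e1 + of_int q' *\<^sub>R e2"
  have uu0: "u = of_int g *\<^sub>R u0" unfolding pq u0_def p' q' by (simp add: scaleR_right_distrib)
  have "t \<in> \<int>" if t: "t *\<^sub>R u0 \<in> int_span e1 e2" for t
  proof -
    obtain m n :: int where "t *\<^sub>R u0 = of_int m *\<^sub>R e1 + of_int n *\<^sub>R e2" using t by (rule int_spanE)
    then have "(t * of_int p') *\<^sub>R e1 + (t * of_int q') *\<^sub>R e2 = of_int m *\<^sub>R e1 + of_int n *\<^sub>R e2"
      by (simp add: u0_def scaleR_right_distrib)
    then have "t * of_int p' = of_int m" "t * of_int q' = of_int n" using coords_unique_eq[OF e] by blast+
    moreover have "t = t * of_int (a * p' + b * q')" using ab by simp
    then have "t = of_int a * (t * of_int p') + of_int b * (t * of_int q')" by (simp add: algebra_simps)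
    ultimately have "t = of_int (a * m + b * n)" by simp
    then show ?thesis by (metis Ints_of_int)
  qed
  then show thesis using that[of u0 "of_int g"] uu0 u(2) int_spanI u0_def by auto
qed

text \<open>Let u0, w0 be primitive on the axes. The sum and difference of x and its reflection lie
  on the axes, so x has half-integral coordinates. Modulo integers, primitivity excludes (1/2, 0)
  and (0, 1/2); hence everything depends on whether (u0 + w0) / 2 is in the lattice. If so, q = 2
  with U, W the halves of u0, w0; if not, q = 1 with U = u0, W = w0.\<close>

lemma reflected_part_structure:
  assumes e: "coords_unique e1 e2"
    and uw: "orthogonal_pair u w" "u \<in> int_span e1 e2" "w \<in> int_span e1 e2"
  obtains U W :: "real^2" and q :: nat where "q = 1 \<or> q = 2" "orthogonal_pair U W"
    "\<exists>k. u = k *\<^sub>R U" "\<exists>k. w = k *\<^sub>R W"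
    "int_span e1 e2 \<inter> line_refl w ` int_span e1 e2 =
       {of_int i *\<^sub>R U + of_int j *\<^sub>R W | i j :: int. int q dvd i - j}"
proof -
  let ?G = "int_span e1 e2"
  note G = additive_subgroup_int_span[of e1 e2]
  have nz: "u \<noteq> 0" "w \<noteq> 0" using uw(1) by (auto simp: orthogonal_pair_def)
  obtain u0 k where u0: "u0 \<in> ?G" "u0 \<noteq> 0" "u = k *\<^sub>R u0" "\<And>t. t *\<^sub>R u0 \<in> ?G \<Longrightarrow> t \<in> \<int>"
    using primitive_vector_exists[OF e uw(2) nz(1)] by blast
  obtain w0 l where w0: "w0 \<in> ?G" "w0 \<noteq> 0" "w = l *\<^sub>R w0" "\<And>t. t *\<^sub>R w0 \<in> ?G \<Longrightarrow> t \<in> \<int>"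
    using primitive_vector_exists[OF e uw(3) nz(2)] by blast
  have kl: "k \<noteq> 0" "l \<noteq> 0" using nz u0 w0 by auto
  have op: "orthogonal_pair u0 w0" using uw(1) u0 w0 kl by (auto simp: orthogonal_pair_def)
  have R: "line_refl w = line_refl w0" unfolding w0(3) using kl by (rule_tac line_refl_scale)
  let ?D = "?G \<inter> line_refl w0 ` ?G"
  have half: "(1/2::real) \<notin> \<int>"
  proof
    assume "(1/2::real) \<in> \<int>"
    then obtain z :: int where "(1/2::real) = of_int z" by (auto elim: Ints_cases)
    then have "1 = real_of_int (2 * z)" by simp
    then have "1 = 2 * z" by linarith
    then show False by presburger
  qed
  have D_iff: "s *\<^sub>R u0 + t *\<^sub>R w0 \<in> ?D \<longleftrightarrow> s *\<^sub>R u0 + t *\<^sub>R w0 \<in> ?G \<and> s *\<^sub>R u0 - t *\<^sub>R w0 \<in> ?G" for s t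
    by (simp add: line_refl_image_iff line_refl_orthogonal(1)[OF op])
  have coords: "\<exists>i j :: int. x = (of_int i / 2) *\<^sub>R u0 + (of_int j / 2) *\<^sub>R w0" if x: "x \<in> ?D" for x
  proof -
    obtain s t where st: "x = s *\<^sub>R u0 + t *\<^sub>R w0"
      using coords_exist[OF orthogonal_pair_coords_unique[OF op]] by blast
    have in': "s *\<^sub>R u0 + t *\<^sub>R w0 \<in> ?G" "s *\<^sub>R u0 - t *\<^sub>R w0 \<in> ?G" using x D_iff unfolding st by blast+
    have "(2 * s) *\<^sub>R u0 \<in> ?G" "(2 * t) *\<^sub>R w0 \<in> ?G"
      using additive_subgroup_add[OF G in'] additive_subgroup_diff[OF G in'] by (simp_all add: scaleR_2 flip: scaleR_scaleR)
    then have "2 * s \<in> \<int>" "2 * t \<in> \<int>" using u0(4) w0(4) by blast+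
    then obtain i j :: int where "2 * s = of_int i" "2 * t = of_int j" by (meson Ints_cases)
    then have "s = of_int i / 2" "t = of_int j / 2" by simp_all
    then show ?thesis using st by blast
  qed
  \<comment> \<open>Integral parts of the coordinates can be removed because u0 and w0 are lattice
    vectors; only the four classes modulo 1 remain.\<close>
  have reduce: "(of_int (i mod 2) / 2) *\<^sub>R u0 + (of_int (j mod 2) / 2) *\<^sub>R w0 \<in> ?G"
    if "(of_int i / 2) *\<^sub>R u0 + (of_int j / 2) *\<^sub>R w0 \<in> ?G" for i j :: int
  proof -
    have mod: "real_of_int i / 2 = of_int (i mod 2) / 2 + of_int (i div 2)" for i :: int
    proof -
      have "real_of_int i = of_int (i mod 2 + i div 2 * 2)" by simp
      then show ?thesis by (simp only: of_int_add of_int_mult) simp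
    qed
    have "(of_int (i mod 2) / 2) *\<^sub>R u0 + (of_int (j mod 2) / 2) *\<^sub>R w0 =
      ((of_int i / 2) *\<^sub>R u0 + (of_int j / 2) *\<^sub>R w0) - (of_int (i div 2) *\<^sub>R u0 + of_int (j div 2) *\<^sub>R w0)"
      unfolding mod[of i] mod[of j] by (simp add: scaleR_left_distrib)
    also have "\<dots> \<in> ?G"
      using u0(1) w0(1) G by (intro additive_subgroup_diff[OF G that] additive_subgroup_add additive_subgroup_scale)
    finally show ?thesis .
  qed
  have parity: "even i \<longleftrightarrow> even j"
    if "(of_int i / 2) *\<^sub>R u0 + (of_int j / 2) *\<^sub>R w0 \<in> ?G" for i j :: int
  proof (rule ccontr)
    assume "even i \<noteq> even j"
    then have "i mod 2 = 1 \<and> j mod 2 = 0 \<or> i mod 2 = 0 \<and> j mod 2 = 1" by presburger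
    then have "(1/2) *\<^sub>R u0 \<in> ?G \<or> (1/2) *\<^sub>R w0 \<in> ?G" using reduce[OF that] by auto
    then show False using u0(4) w0(4) half by blast
  qed
  show thesis
  proof (cases "(1/2) *\<^sub>R u0 + (1/2) *\<^sub>R w0 \<in> ?G")
    case True
    define U W where "U = (1/2) *\<^sub>R u0" and "W = (1/2) *\<^sub>R w0"
    have "?D = {of_int i *\<^sub>R U + of_int j *\<^sub>R W | i j :: int. int 2 dvd i - j}"
    proof (intro equalityI subsetI)
      fix x assume x: "x \<in> ?D"
      obtain i j :: int where ij: "x = (of_int i / 2) *\<^sub>R u0 + (of_int j / 2) *\<^sub>R w0" using coords[OF x] by blast
      then have "even i \<longleftrightarrow> even j" using parity x by blast
      then have "int 2 dvd i - j" by simp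
      moreover have "x = of_int i *\<^sub>R U + of_int j *\<^sub>R W" by (simp add: ij U_def W_def)
      ultimately show "x \<in> {of_int i *\<^sub>R U + of_int j *\<^sub>R W | i j :: int. int 2 dvd i - j}" by blast
    next
      fix x assume "x \<in> {of_int i *\<^sub>R U + of_int j *\<^sub>R W | i j :: int. int 2 dvd i - j}"
      then obtain i j :: int where x: "x = of_int i *\<^sub>R U + of_int j *\<^sub>R W" and ij: "even (i - j)" by auto
      have UW: "of_int i *\<^sub>R U + of_int j *\<^sub>R W \<in> ?G" if "even (i - j)" for i j :: int
      proof -
        obtain d where d: "i = j + 2 * d" using \<open>even (i - j)\<close> by (metis dvdE diff_add_cancel add.commute)
        have "of_int i *\<^sub>R U + of_int j *\<^sub>R W = of_int j *\<^sub>R ((1/2) *\<^sub>R u0 + (1/2) *\<^sub>R w0) + of_int d *\<^sub>R u0"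
          by (simp add: d U_def W_def add_divide_distrib scaleR_left_distrib scaleR_right_distrib)
        also have "\<dots> \<in> ?G" using u0(1) by (intro additive_subgroup_add[OF G] additive_subgroup_scale[OF G True] additive_subgroup_scale[OF G])
        finally show ?thesis .
      qed
      have "of_int i *\<^sub>R U + of_int (- j) *\<^sub>R W \<in> ?G" using ij by (intro UW) auto
      then show "x \<in> ?D" using UW[OF ij] D_iff[of "of_int i / 2" "of_int j / 2"] by (simp add: x U_def W_def)
    qed
    moreover have "orthogonal_pair U W" using op by (simp add: orthogonal_pair_def U_def W_def)
    moreover have "u = (2 * k) *\<^sub>R U" "w = (2 * l) *\<^sub>R W" using u0(3) w0(3) by (simp_all add: U_def W_def)
    ultimately show thesis using that[of 2 U W] unfolding R by blast
  next
    case False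
    have "?D = {of_int i *\<^sub>R u0 + of_int j *\<^sub>R w0 | i j :: int. int 1 dvd i - j}"
    proof (intro equalityI subsetI)
      fix x assume x: "x \<in> ?D"
      obtain i j :: int where ij: "x = (of_int i / 2) *\<^sub>R u0 + (of_int j / 2) *\<^sub>R w0" using coords[OF x] by blast
      then have in': "(of_int i / 2) *\<^sub>R u0 + (of_int j / 2) *\<^sub>R w0 \<in> ?G" using x by blast
      have "even i"
      proof (rule ccontr)
        assume "odd i"
        then have "odd j" using parity[OF in'] by blast
        with \<open>odd i\<close> have "i mod 2 = 1" "j mod 2 = 1" by presburger+
        then show False using reduce[OF in'] False by simp
      qed
      then obtain a b where "i = 2 * a" "j = 2 * b" using parity[OF in'] by (meson dvdE)
      then have "x = of_int a *\<^sub>R u0 + of_int b *\<^sub>R w0" by (simp add: ij)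
      then show "x \<in> {of_int i *\<^sub>R u0 + of_int j *\<^sub>R w0 | i j :: int. int 1 dvd i - j}" by auto
    next
      fix x assume "x \<in> {of_int i *\<^sub>R u0 + of_int j *\<^sub>R w0 | i j :: int. int 1 dvd i - j}"
      then obtain i j :: int where x: "x = of_int i *\<^sub>R u0 + of_int j *\<^sub>R w0" by auto
      show "x \<in> ?D" unfolding x D_iff using u0(1) w0(1) G
        by (intro conjI additive_subgroup_diff additive_subgroup_add additive_subgroup_scale)
    qed
    then show thesis using that[of 1 u0 w0] op u0(3) w0(3) unfolding R by blast
  qed
qed

section \<open>Reduced bases of well-rounded lattices\<close>

text \<open>Two independent minimal vectors a, b already generate: rounding the coordinates of a
  lattice vector leaves a lattice vector shorter than a, which must be 0. The bound on the inner
  product is the minimality of a compared with a + b and a - b.\<close>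

lemma well_rounded_basis:
  assumes L: "additive_subgroup \<Lambda>" and wr: "well_rounded \<Lambda>"
  obtains a b where "coords_unique a b" "\<Lambda> = int_span a b" "a \<bullet> a = b \<bullet> b" "2 * \<bar>a \<bullet> b\<bar> \<le> a \<bullet> a"
proof -
  let ?M = "minimal_vectors \<Lambda>"
  obtain B where B: "B \<subseteq> ?M" "independent B" "?M \<subseteq> span B" "card B = dim ?M"
    by (rule basis_exists)
  have "dim ?M = dim (span ?M)" by simp
  also have "\<dots> = 2" using wr unfolding well_rounded_def by simp
  finally have "card B = 2" using B(4) by simp
  then obtain a b where ab: "B = {a, b}" "a \<noteq> b" by (auto simp: card_2_iff)
  then have cu: "coords_unique a b" using B(2) by (simp add: coords_unique_iff_independent)
  have min: "a \<in> \<Lambda>" "b \<in> \<Lambda>" "a \<noteq> 0" "b \<noteq> 0"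
    "\<And>x. x \<in> \<Lambda> \<Longrightarrow> x \<noteq> 0 \<Longrightarrow> norm a \<le> norm x" "\<And>x. x \<in> \<Lambda> \<Longrightarrow> x \<noteq> 0 \<Longrightarrow> norm b \<le> norm x"
    using B(1) ab unfolding minimal_vectors_def by auto
  have "norm a = norm b" using min by (metis order_antisym)
  then have eq: "a \<bullet> a = b \<bullet> b" by (simp add: norm_eq)
  have short: "a \<bullet> a \<le> x \<bullet> x" if "x \<in> \<Lambda>" "x \<noteq> 0" for x
    using min(5)[OF that] by (simp add: norm_le)
  have "a + b \<noteq> 0" "a - b \<noteq> 0"
    using cu[unfolded coords_unique_def, rule_format, of 1 1] ab(2) by auto
  then have "a \<bullet> a \<le> (a + b) \<bullet> (a + b)" "a \<bullet> a \<le> (a - b) \<bullet> (a - b)"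
    using min additive_subgroupD[OF L] by (auto intro!: short)
  then have ip: "2 * \<bar>a \<bullet> b\<bar> \<le> a \<bullet> a"
    using eq by (simp add: inner_add_left inner_add_right inner_diff_left inner_diff_right inner_commute[of b a])
  have "\<Lambda> \<subseteq> int_span a b"
  proof
    fix x assume x: "x \<in> \<Lambda>"
    obtain s t where st: "x = s *\<^sub>R a + t *\<^sub>R b" using coords_exist[OF cu] by blast
    define s' t' where "s' = s - of_int (round s)" and "t' = t - of_int (round t)"
    define y where "y = of_int (round s) *\<^sub>R a + of_int (round t) *\<^sub>R b"
    have y: "y \<in> \<Lambda>" unfolding y_def using min by (intro additive_subgroup_add[OF L] additive_subgroup_scale[OF L])
    have xy: "x - y = s' *\<^sub>R a + t' *\<^sub>R b" by (simp add: st y_def s'_def t'_def algebra_simps)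
    have abs: "\<bar>s'\<bar> \<le> 1/2" "\<bar>t'\<bar> \<le> 1/2"
      using of_int_round_abs_le[of s] of_int_round_abs_le[of t] by (simp_all add: s'_def t'_def abs_minus_commute)
    have "s' * s' \<le> 1/4" "t' * t' \<le> 1/4" "\<bar>s' * t'\<bar> \<le> 1/4"
      using mult_mono[OF abs(1) abs(1)] mult_mono[OF abs(2) abs(2)] mult_mono[OF abs(1) abs(2)] by (simp_all add: abs_mult)
    have "(x - y) \<bullet> (x - y) = (s' * s') * (a \<bullet> a) + (t' * t') * (a \<bullet> a) + 2 * ((s' * t') * (a \<bullet> b))"
      unfolding xy using eq by (simp add: inner_add_left inner_add_right inner_commute[of b a] algebra_simps)
    \<comment> \<open>Each of the three terms is at most a quarter of |a|^2, so the remainder has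
      squared length at most 3/4 |a|^2.\<close>
    also have "\<dots> \<le> (1/4) * (a \<bullet> a) + (1/4) * (a \<bullet> a) + 2 * ((1/4) * (a \<bullet> a / 2))"
    proof -
      have "(s' * t') * (a \<bullet> b) \<le> \<bar>s' * t'\<bar> * \<bar>a \<bullet> b\<bar>" by (simp flip: abs_mult)
      also have "\<dots> \<le> (1/4) * (a \<bullet> a / 2)" using \<open>\<bar>s' * t'\<bar> \<le> 1/4\<close> ip by (intro mult_mono) auto
      finally show ?thesis using \<open>s' * s' \<le> 1/4\<close> \<open>t' * t' \<le> 1/4\<close>
        by (intro add_mono mult_right_mono mult_left_mono) auto
    qed
    also have "\<dots> < a \<bullet> a" using min(3) by simp
    finally have "x - y = 0" using short[OF additive_subgroup_diff[OF L x y]] by force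
    then have "x = y" by simp
    then show "x \<in> int_span a b" unfolding y_def by (simp add: int_spanI)
  qed
  then have "\<Lambda> = int_span a b" using int_span_subset[OF L min(1,2)] by blast
  then show thesis using that cu eq ip by blast
qed

text \<open>The squared length of m a + n b is at least (m^2 + n^2 - |m n|) |a|^2, and this integer
  form equals (|m| - |n|)^2 + |m n|, which is at least 1 unless m = n = 0.\<close>

lemma well_rounded_int_span:
  assumes cu: "coords_unique a b" and eq: "a \<bullet> a = b \<bullet> b" and ip: "2 * \<bar>a \<bullet> b\<bar> \<le> a \<bullet> a"
  shows "well_rounded (int_span a b)"
proof -
  have nz: "a \<noteq> 0" "b \<noteq> 0"
    using cu[unfolded coords_unique_def, rule_format, of 1 0] cu[unfolded coords_unique_def, rule_format, of 0 1] by auto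
  have short: "a \<bullet> a \<le> x \<bullet> x" if x: "x \<in> int_span a b" "x \<noteq> 0" for x
  proof -
    obtain m n :: int where mn: "x = of_int m *\<^sub>R a + of_int n *\<^sub>R b" using x(1) by (rule int_spanE)
    define P where "P = m * m + n * n - \<bar>m * n\<bar>"
    have "(\<bar>m\<bar> - \<bar>n\<bar>)\<^sup>2 + \<bar>m * n\<bar> = P"
      by (simp add: P_def power2_eq_square abs_mult algebra_simps)
    moreover have "(\<bar>m\<bar> - \<bar>n\<bar>)\<^sup>2 > 0 \<or> \<bar>m * n\<bar> > 0" using x(2) mn by auto
    ultimately have "P \<ge> 1" by (smt (verit) zero_le_power2)
    have "a \<bullet> a \<le> of_int P * (a \<bullet> a)"
      using mult_right_mono[of 1 "real_of_int P" "a \<bullet> a"] \<open>P \<ge> 1\<close> by simp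
    also have "\<dots> = of_int (m * m) * (a \<bullet> a) + of_int (n * n) * (a \<bullet> a) - of_int \<bar>m * n\<bar> * (a \<bullet> a)"
      by (simp add: P_def algebra_simps)
    also have "\<dots> \<le> of_int (m * m) * (a \<bullet> a) + of_int (n * n) * (a \<bullet> a) + 2 * (of_int (m * n) * (a \<bullet> b))"
    proof -
      have "- (of_int (m * n) * (a \<bullet> b)) \<le> \<bar>of_int (m * n)\<bar> * \<bar>a \<bullet> b\<bar>"
        using abs_ge_minus_self[of "of_int (m * n) * (a \<bullet> b)"] by (simp only: abs_mult)
      also have "\<dots> \<le> \<bar>of_int (m * n)\<bar> * (a \<bullet> a / 2)" using ip by (intro mult_left_mono) auto
      finally show ?thesis by simp
    qed
    also have "\<dots> = x \<bullet> x"
      unfolding mn using eq by (simp add: inner_add_left inner_add_right inner_commute[of b a] algebra_simps)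
    finally show ?thesis .
  qed
  have "{a, b} \<subseteq> minimal_vectors (int_span a b)"
    using nz int_span_gens[of a b] int_span_gens[where u=a and v=b] short eq
    by (auto simp: minimal_vectors_def norm_le)
  then have "span {a, b} \<subseteq> span (minimal_vectors (int_span a b))" by (rule span_mono)
  moreover have "UNIV \<subseteq> span {a, b}"
    using cu by (intro card_ge_dim_independent) (auto simp: coords_unique_iff_independent)
  ultimately show ?thesis unfolding well_rounded_def by blast
qed

section \<open>Parametrisation of the well-rounded sublattices\<close>

lemma int_span_eqI:
  assumes "x' \<in> int_span x y" "y' \<in> int_span x y" "x \<in> int_span x' y'" "y \<in> int_span x' y'"
  shows "int_span x y = int_span x' y'"
  using assms by (intro equalityI int_span_subset additive_subgroup_int_span)

lemma int_span_commute: "int_span x y = int_span y x"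
  by (intro int_span_eqI int_span_gens)

lemma int_span_uminus: "int_span x (- y) = int_span x y"
proof (rule int_span_eqI)
  have "- (- y) \<in> int_span x (- y)"
    by (rule additive_subgroup_uminus[OF additive_subgroup_int_span int_span_gens(2)])
  then show "y \<in> int_span x (- y)" by simp
qed (auto intro!: additive_subgroup_uminus[OF additive_subgroup_int_span] int_span_gens)

lemma int_span_add: "int_span x y = int_span (x + y) x"
proof (rule int_span_eqI)
  have "(x + y) - x \<in> int_span (x + y) x"
    by (intro additive_subgroup_diff additive_subgroup_int_span int_span_gens)
  then show "y \<in> int_span (x + y) x" by simp
qed (auto intro!: additive_subgroup_add[OF additive_subgroup_int_span] int_span_gens)

text \<open>A centred rectangular lattice: the sum and difference of the generators are 2 m U and 2
  n W. The parameters are integers because coordinates arise with signs, which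
  \<open>rhombic_abs\<close> removes.\<close>

definition rhombic :: "real^2 \<Rightarrow> real^2 \<Rightarrow> int \<Rightarrow> int \<Rightarrow> (real^2) set" where
  "rhombic U W m n = int_span (of_int m *\<^sub>R U + of_int n *\<^sub>R W) (of_int m *\<^sub>R U - of_int n *\<^sub>R W)"

lemma rhombic_minus_right: "rhombic U W m (- n) = rhombic U W m n"
  unfolding rhombic_def by (simp add: int_span_commute)

lemma rhombic_minus_left: "rhombic U W (- m) n = rhombic U W m n"
proof -
  have "rhombic U W (- m) n = int_span (- (of_int m *\<^sub>R U - of_int n *\<^sub>R W)) (- (of_int m *\<^sub>R U + of_int n *\<^sub>R W))"
    unfolding rhombic_def by simp
  also have "\<dots> = rhombic U W m n"
    unfolding rhombic_def int_span_uminus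
    by (subst int_span_commute) (simp only: int_span_uminus)
  finally show ?thesis .
qed

lemma rhombic_abs: "rhombic U W \<bar>m\<bar> \<bar>n\<bar> = rhombic U W m n"
  by (simp add: abs_if rhombic_minus_left rhombic_minus_right)

text \<open>Vectors of \<open>rhombic U W m' n'\<close> have coordinates (s + t) m' and (s - t) n'.
  Applied in both directions this recovers positive parameters from the lattice.\<close>

lemma rhombic_dvd:
  assumes "coords_unique U W" "rhombic U W m n \<subseteq> rhombic U W m' n'"
  shows "m' dvd m" "n' dvd n"
proof -
  have "of_int m *\<^sub>R U + of_int n *\<^sub>R W \<in> rhombic U W m' n'"
    using assms(2) int_span_gens(1) unfolding rhombic_def by blast
  then obtain s t :: int where "of_int m *\<^sub>R U + of_int n *\<^sub>R W =
      of_int s *\<^sub>R (of_int m' *\<^sub>R U + of_int n' *\<^sub>R W) + of_int t *\<^sub>R (of_int m' *\<^sub>R U - of_int n' *\<^sub>R W)"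
    unfolding rhombic_def by (rule int_spanE)
  also have "\<dots> = of_int ((s + t) * m') *\<^sub>R U + of_int ((s - t) * n') *\<^sub>R W"
    by (simp add: algebra_simps)
  finally have "real_of_int m = of_int ((s + t) * m')" "real_of_int n = of_int ((s - t) * n')"
    using coords_unique_eq[OF assms(1)] by blast+
  then have "m = (s + t) * m'" "n = (s - t) * n'" by linarith+
  then show "m' dvd m" "n' dvd n" by simp_all
qed

lemma rhombic_inj:
  assumes "coords_unique U W" "rhombic U W (int m) (int n) = rhombic U W (int m') (int n')"
  shows "m = m'" "n = n'"
  using rhombic_dvd[OF assms(1), of "int m" "int n" "int m'" "int n'"]
    rhombic_dvd[OF assms(1), of "int m'" "int n'" "int m" "int n"] assms(2)
  by (auto intro: dvd_antisym)

text \<open>In the basis X = q U, Y = U + W of \<open>D\<close>, the rhombic lattice has a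
  triangular basis with diagonal entries (2 / q) m and n. The index is stated multiplied by q to
  avoid division.\<close>

lemma
  fixes q :: nat and m n :: int
  assumes UW: "coords_unique U W" and q: "q = 1 \<or> q = 2"
    and mn: "m > 0" "n > 0" "int q dvd m - n"
  defines "D \<equiv> {of_int i *\<^sub>R U + of_int j *\<^sub>R W | i j :: int. int q dvd i - j}"
  shows sublattice_rhombic: "sublattice (rhombic U W m n) D"
    and subgroup_index_rhombic: "int q * int (subgroup_index D (rhombic U W m n)) = 2 * m * n"
proof -
  define X Y where "X = real q *\<^sub>R U" and "Y = U + W"
  have D: "D = int_span X Y"
  proof (intro equalityI subsetI)
    fix x assume "x \<in> D"
    then obtain i j :: int where x: "x = of_int i *\<^sub>R U + of_int j *\<^sub>R W" and ij: "int q dvd i - j"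
      by (auto simp: D_def)
    obtain d where d: "i - j = int q * d" using ij by (rule dvdE)
    have "real_of_int i = of_int j + of_int d * real q" 
    proof -
      have "real_of_int i = of_int (j + int q * d)" using d by (simp add: algebra_simps)
      then show ?thesis by simp
    qed
    then have "x = of_int d *\<^sub>R X + of_int j *\<^sub>R Y" by (simp add: x X_def Y_def algebra_simps)
    then show "x \<in> int_span X Y" by (simp add: int_spanI)
  next
    fix x assume "x \<in> int_span X Y"
    then obtain d j :: int where x: "x = of_int d *\<^sub>R X + of_int j *\<^sub>R Y" by (rule int_spanE)
    have "x = of_int (j + int q * d) *\<^sub>R U + of_int j *\<^sub>R W" by (simp add: x X_def Y_def algebra_simps)
    moreover have "int q dvd (j + int q * d) - j" by simp
    ultimately show "x \<in> D" unfolding D_def by blast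
  qed
  have XY: "coords_unique X Y" unfolding coords_unique_def
  proof (intro allI impI)
    fix a b assume "a *\<^sub>R X + b *\<^sub>R Y = 0"
    then have "(a * real q + b) *\<^sub>R U + b *\<^sub>R W = 0" by (simp add: X_def Y_def algebra_simps)
    then have "a * real q + b = 0 \<and> b = 0" using UW unfolding coords_unique_def by blast
    then show "a = 0 \<and> b = 0" using q by auto
  qed
  obtain a where a: "2 = int q * a" using q by (metis dvdE dvd_refl int_ops(2) int_ops(3) of_nat_numeral one_dvd)
  obtain b where b: "m - n = int q * b" using mn(3) by (rule dvdE)
  have "a > 0" using a q by auto
  have ra: "2 = real q * of_int a" and rb: "real_of_int m = of_int n + real q * of_int b"
  proof -
    have "real_of_int 2 = of_int (int q * a)" using a by (rule arg_cong)
    then show "2 = real q * of_int a" by simp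
    have "real_of_int m = of_int (n + int q * b)" using b by (simp add: algebra_simps)
    then show "real_of_int m = of_int n + real q * of_int b" by simp
  qed
  \<comment> \<open>Trading the second generator for the sum of the two, which is 2 m U, produces
    the triangular form.\<close>
  have "rhombic U W m n = int_span ((2 * of_int m) *\<^sub>R U) (of_int m *\<^sub>R U + of_int n *\<^sub>R W)"
  proof -
    have "(of_int m *\<^sub>R U + of_int n *\<^sub>R W) + (of_int m *\<^sub>R U - of_int n *\<^sub>R W) = (2 * of_int m) *\<^sub>R U"
      by (simp add: scaleR_2 flip: scaleR_scaleR)
    then show ?thesis unfolding rhombic_def by (subst int_span_add) simp
  qed
  also have "(2 * of_int m) *\<^sub>R U = of_int (a * m) *\<^sub>R X"
    unfolding X_def by (subst ra) (simp add: mult_ac)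
  also have "of_int m *\<^sub>R U + of_int n *\<^sub>R W = of_int b *\<^sub>R X + of_int n *\<^sub>R Y"
    unfolding X_def Y_def rb by (simp add: algebra_simps)
  finally have rh: "rhombic U W m n = int_span (of_int (a * m) *\<^sub>R X) (of_int b *\<^sub>R X + of_int n *\<^sub>R Y)" .
  have am: "a * m > 0" using \<open>a > 0\<close> mn by simp
  show "sublattice (rhombic U W m n) D"
    unfolding D rh by (rule sublattice_hermite[OF XY am mn(2)])
  have "int (subgroup_index D (rhombic U W m n)) = a * m * n"
    unfolding D rh subgroup_index_hermite[OF XY am mn(2)] using am mn by simp
  then show "int q * int (subgroup_index D (rhombic U W m n)) = 2 * m * n"
    using a by (simp add: mult.assoc)
qed

text \<open>For half-diagonals X = m |U| and Y = n |W| one has |a|^2 = X^2 + Y^2 and a . b = X^2 -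
  Y^2. The condition becomes X^2 \<le> 3 Y^2 and Y^2 \<le> 3 X^2, the source of sqrt 3.\<close>

lemma rhombic_short_iff:
  fixes m n :: real
  assumes UW: "orthogonal_pair U W" and mn: "m > 0" "n > 0"
  defines "a \<equiv> m *\<^sub>R U + n *\<^sub>R W" and "b \<equiv> m *\<^sub>R U - n *\<^sub>R W"
  shows "2 * \<bar>a \<bullet> b\<bar> \<le> a \<bullet> a \<longleftrightarrow> norm U / (sqrt 3 * norm W) * m \<le> n \<and> n \<le> sqrt 3 * norm U / norm W * m"
proof -
  define X Y where "X = m * norm U" and "Y = n * norm W"
  have pos: "norm U > 0" "norm W > 0" using UW by (auto simp: orthogonal_pair_def)
  then have XY: "X > 0" "Y > 0" using mn by (auto simp: X_def Y_def)
  have "a \<bullet> a = X\<^sup>2 + Y\<^sup>2" "a \<bullet> b = X\<^sup>2 - Y\<^sup>2"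
    unfolding a_def b_def X_def Y_def
    using orthogonal_pair_inner[OF UW, of m n m n] orthogonal_pair_inner[OF UW, of m n m "- n"]
    by (simp_all add: power2_norm_eq_inner power_mult_distrib) (simp_all add: power2_eq_square)
  then have "2 * \<bar>a \<bullet> b\<bar> \<le> a \<bullet> a \<longleftrightarrow> X\<^sup>2 \<le> 3 * Y\<^sup>2 \<and> Y\<^sup>2 \<le> 3 * X\<^sup>2" by linarith
  also have "\<dots> \<longleftrightarrow> X\<^sup>2 \<le> (sqrt 3 * Y)\<^sup>2 \<and> Y\<^sup>2 \<le> (sqrt 3 * X)\<^sup>2" by (simp add: power_mult_distrib)
  also have "\<dots> \<longleftrightarrow> X \<le> sqrt 3 * Y \<and> Y \<le> sqrt 3 * X" using XY by (simp add: power2_le_iff_abs_le abs_mult)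
  also have "\<dots> \<longleftrightarrow> norm U / (sqrt 3 * norm W) * m \<le> n \<and> n \<le> sqrt 3 * norm U / norm W * m"
    using pos by (simp add: X_def Y_def field_simps)
  finally show ?thesis .
qed

text \<open>The diagonals of a rhombus are perpendicular; independence of the sides keeps them
  non-zero.\<close>

lemma orthogonal_pair_of_rhombus:
  assumes "coords_unique a b" "a \<bullet> a = b \<bullet> b"
  shows "orthogonal_pair (a + b) (a - b)"
  using assms(1)[unfolded coords_unique_def, rule_format, of 1 1]
    assms(1)[unfolded coords_unique_def, rule_format, of 1 "- 1"] assms(2)
  by (auto simp: orthogonal_pair_def inner_add_left inner_diff_right inner_commute[of b a])

text \<open>
  For \<open>q = 1\<close> the lattice \<open>\<Gamma> \<inter> R\<Gamma>\<close> is rectangular with basis \<open>U, W\<close>; for \<open>q = 2\<close> it is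
  rhombic with basis \<open>U + W, U - W\<close>.
\<close>

locale axial_lattice =
  fixes e1 e2 U W :: "real^2" and q :: nat
  assumes basis: "coords_unique e1 e2"
    and non_rational: "\<not> rational_lattice (int_span e1 e2)"
    and q: "q = 1 \<or> q = 2"
    and axes: "orthogonal_pair U W"
    and reflected_part: "int_span e1 e2 \<inter> line_refl W ` int_span e1 e2 =
       {of_int i *\<^sub>R U + of_int j *\<^sub>R W | i j :: int. int q dvd i - j}"
begin

abbreviation "\<Gamma> \<equiv> int_span e1 e2"
abbreviation "\<Gamma>\<^sub>R \<equiv> \<Gamma> \<inter> line_refl W ` \<Gamma>"
text \<open>The bounds 1 / sqrt 3 and sqrt 3 for the ratio of the half-diagonals, rescaled to bounds
  for n / m. The rescaling cancels in \<beta> / \<alpha>, so this quotient is 3 whatever U and W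
  are.\<close>

definition "\<alpha> = norm U / (sqrt 3 * norm W)"
definition "\<beta> = sqrt 3 * norm U / norm W"

definition wr_params :: "(nat \<times> nat) set" where
  "wr_params = {(m, n). 0 < m \<and> 0 < n \<and> int q dvd int m - int n \<and>
     \<alpha> * real m \<le> real n \<and> real n \<le> \<beta> * real m}"

definition wr_lattice :: "nat \<times> nat \<Rightarrow> (real^2) set" where
  "wr_lattice p = rhombic U W (int (fst p)) (int (snd p))"

lemma axes_unique: "coords_unique U W"
  using axes by (rule orthogonal_pair_coords_unique)

lemma ratio: "0 < \<alpha>" "\<alpha> < \<beta>" "\<beta> / \<alpha> = 3"
proof -
  have pos: "norm U > 0" "norm W > 0" using axes by (auto simp: orthogonal_pair_def)
  then show 1: "0 < \<alpha>" by (simp add: \<alpha>_def)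
  show 2: "\<beta> / \<alpha> = 3" using pos by (simp add: \<alpha>_def \<beta>_def field_simps)
  have "\<beta> = 3 * \<alpha>" using 1 2 by (simp add: field_simps)
  then show "\<alpha> < \<beta>" using 1 by simp
qed

text \<open>For q = 2 the vectors U and W violate the congruence; their q-fold multiples satisfy it,
  and they provide the orthogonal pair inside the lattice.\<close>

lemma axis_multiples_in: "real q *\<^sub>R U \<in> \<Gamma>" "real q *\<^sub>R W \<in> \<Gamma>"
proof -
  have "of_int (int q) *\<^sub>R U + of_int 0 *\<^sub>R W \<in> \<Gamma>\<^sub>R" "of_int 0 *\<^sub>R U + of_int (int q) *\<^sub>R W \<in> \<Gamma>\<^sub>R"
    unfolding reflected_part by (intro CollectI exI conjI, rule refl, simp)+
  then show "real q *\<^sub>R U \<in> \<Gamma>" "real q *\<^sub>R W \<in> \<Gamma>" by simp_all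
qed

lemma axis_multiples_orthogonal: "orthogonal_pair (real q *\<^sub>R U) (real q *\<^sub>R W)"
  using axes q by (auto simp: orthogonal_pair_def)

lemma coincidence_reflections: "coincidence_reflections \<Gamma> = {line_refl W, \<lambda>x. - line_refl W x}"
proof -
  have "line_refl (real q *\<^sub>R W) = line_refl W" using q by (intro line_refl_scale) auto
  then show ?thesis
    using coincidence_reflections_eq[OF basis non_rational axis_multiples_orthogonal axis_multiples_in] by simp
qed

lemma sublattice_reflected_part: "sublattice \<Gamma>\<^sub>R \<Gamma>"
  using coincidence_reflections by (auto simp: coincidence_reflections_def)

definition "\<Sigma> = subgroup_index \<Gamma> \<Gamma>\<^sub>R"

lemma \<Sigma>_pos: "\<Sigma> > 0"
  unfolding \<Sigma>_def by (intro subgroup_index_pos sublattice_reflected_part additive_subgroup_int_span)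

text \<open>The index is computed in two stages through \<open>\<Gamma>\<^sub>R\<close>: the factor
  \<Sigma> from \<open>\<Gamma>\<close> to \<open>\<Gamma>\<^sub>R\<close>, then 2 m n / q.\<close>

lemma wr_lattice_well_rounded:
  assumes "p \<in> wr_params"
  shows "sublattice (wr_lattice p) \<Gamma>" "well_rounded (wr_lattice p)"
    "q * subgroup_index \<Gamma> (wr_lattice p) = 2 * \<Sigma> * fst p * snd p"
proof -
  obtain m n where p: "p = (m, n)" by (cases p)
  have mn: "0 < int m" "0 < int n" "int q dvd int m - int n"
    and bounds: "\<alpha> * real m \<le> real n" "real n \<le> \<beta> * real m"
    using assms by (auto simp: wr_params_def p)
  have sub: "sublattice (wr_lattice p) \<Gamma>\<^sub>R"
    and idx: "int q * int (subgroup_index \<Gamma>\<^sub>R (wr_lattice p)) = 2 * int m * int n"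
    unfolding wr_lattice_def p fst_conv snd_conv reflected_part
    using sublattice_rhombic[OF axes_unique q mn] subgroup_index_rhombic[OF axes_unique q mn] by simp_all
  note G = additive_subgroup_int_span[of e1 e2]
  show "sublattice (wr_lattice p) \<Gamma>"
    by (rule sublattice_trans[OF G sublattice_reflected_part sub])
  have "int (q * subgroup_index \<Gamma>\<^sub>R (wr_lattice p)) = int (2 * m * n)" using idx by simp
  then have "q * subgroup_index \<Gamma>\<^sub>R (wr_lattice p) = 2 * m * n" by (simp only: of_nat_eq_iff)
  moreover have "subgroup_index \<Gamma> (wr_lattice p) = \<Sigma> * subgroup_index \<Gamma>\<^sub>R (wr_lattice p)"
    unfolding \<Sigma>_def by (rule subgroup_index_mult[OF G sublattice_reflected_part sub])
  ultimately have "q * subgroup_index \<Gamma> (wr_lattice p) = \<Sigma> * (2 * m * n)"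
    by (metis mult.left_commute)
  then show "q * subgroup_index \<Gamma> (wr_lattice p) = 2 * \<Sigma> * fst p * snd p"
    by (simp add: p)
  define a b where "a = real m *\<^sub>R U + real n *\<^sub>R W" and "b = real m *\<^sub>R U - real n *\<^sub>R W"
  have "2 * \<bar>a \<bullet> b\<bar> \<le> a \<bullet> a"
    using rhombic_short_iff[OF axes, of "real m" "real n"] mn bounds unfolding a_def b_def \<alpha>_def \<beta>_def by simp
  moreover have "a \<bullet> a = b \<bullet> b"
    using orthogonal_pair_inner[OF axes, of "real m" "real n" "real m" "real n"]
      orthogonal_pair_inner[OF axes, of "real m" "- real n" "real m" "- real n"] by (simp add: a_def b_def)
  moreover have "coords_unique a b" unfolding coords_unique_def
  proof (intro allI impI)
    fix s t assume "s *\<^sub>R a + t *\<^sub>R b = 0"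
    then have "((s + t) * real m) *\<^sub>R U + ((s - t) * real n) *\<^sub>R W = 0" by (simp add: a_def b_def algebra_simps)
    then have "(s + t) * real m = 0 \<and> (s - t) * real n = 0" using axes_unique unfolding coords_unique_def by blast
    then show "s = 0 \<and> t = 0" using mn by auto
  qed
  ultimately have "well_rounded (int_span a b)" by (intro well_rounded_int_span)
  then show "well_rounded (wr_lattice p)" by (simp add: wr_lattice_def rhombic_def p a_def b_def)
qed

lemma inj_on_wr_lattice: "inj_on wr_lattice wr_params"
proof (rule inj_onI)
  fix p p' assume "wr_lattice p = wr_lattice p'"
  then have "fst p = fst p'" "snd p = snd p'"
    unfolding wr_lattice_def using rhombic_inj[OF axes_unique] by blast+
  then show "p = p'" by (rule prod_eqI)
qed

text \<open>The diagonals of a reduced basis are parallel to the axes, so the reflection exchanges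
  the two generators (up to the sign of one). This puts a generator into
  \<open>\<Gamma>\<^sub>R\<close>, which makes its coordinates integral and gives the
  congruence.\<close>

lemma well_rounded_sublattice_param:
  assumes sub: "sublattice \<Lambda> \<Gamma>" and wr: "well_rounded \<Lambda>"
  shows "\<Lambda> \<in> wr_lattice ` wr_params"
proof -
  note G = additive_subgroup_int_span[of e1 e2]
  have L: "additive_subgroup \<Lambda>" "\<Lambda> \<subseteq> \<Gamma>" using sub by (auto simp: sublattice_iff[OF G])
  obtain a b where ab: "coords_unique a b" "\<Lambda> = int_span a b" "a \<bullet> a = b \<bullet> b" "2 * \<bar>a \<bullet> b\<bar> \<le> a \<bullet> a"
    using well_rounded_basis[OF L(1) wr] by blast
  have in': "a \<in> \<Gamma>" "b \<in> \<Gamma>" using L(2) ab(2) int_span_gens by blast+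
  have "(\<exists>k l. a + b = k *\<^sub>R (real q *\<^sub>R U) \<and> a - b = l *\<^sub>R (real q *\<^sub>R W)) \<or>
      (\<exists>k l. a + b = k *\<^sub>R (real q *\<^sub>R W) \<and> a - b = l *\<^sub>R (real q *\<^sub>R U))"
    by (intro orthogonal_pairs_parallel[OF basis non_rational] axis_multiples_orthogonal axis_multiples_in
        orthogonal_pair_of_rhombus ab additive_subgroup_add[OF G] additive_subgroup_diff[OF G] in')
  then have "\<exists>b' k l. \<Lambda> = int_span a b' \<and> b' \<in> \<Gamma> \<and> coords_unique a b' \<and> 2 * \<bar>a \<bullet> b'\<bar> \<le> a \<bullet> a \<and>
      a + b' = k *\<^sub>R U \<and> a - b' = l *\<^sub>R W"
  proof (elim disjE exE conjE)
    fix k l assume "a + b = k *\<^sub>R (real q *\<^sub>R U)" "a - b = l *\<^sub>R (real q *\<^sub>R W)"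
    then show ?thesis using ab in' by (intro exI[of _ b] exI[of _ "k * real q"] exI[of _ "l * real q"]) simp
  next
    \<comment> \<open>Replacing b by -b exchanges the two diagonals, so the sum may be assumed to
      lie on the axis of U.\<close>
    fix k l assume *: "a + b = k *\<^sub>R (real q *\<^sub>R W)" "a - b = l *\<^sub>R (real q *\<^sub>R U)"
    have "coords_unique a (- b)" unfolding coords_unique_def
    proof (intro allI impI)
      fix s t assume "s *\<^sub>R a + t *\<^sub>R (- b) = 0"
      then have "s *\<^sub>R a + (- t) *\<^sub>R b = 0" by simp
      then have "s = 0 \<and> - t = 0" using ab(1) unfolding coords_unique_def by blast
      then show "s = 0 \<and> t = 0" by simp
    qed
    then show ?thesis using ab in' * additive_subgroup_uminus[OF G in'(2)]
      by (intro exI[of _ "- b"] exI[of _ "l * real q"] exI[of _ "k * real q"]) (simp add: int_span_uminus)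
  qed
  then obtain c k l where c: "\<Lambda> = int_span a c" "c \<in> \<Gamma>" "coords_unique a c" "2 * \<bar>a \<bullet> c\<bar> \<le> a \<bullet> a"
    and kl: "a + c = k *\<^sub>R U" "a - c = l *\<^sub>R W" by blast
  have "a = (1/2) *\<^sub>R ((a + c) + (a - c))" "c = (1/2) *\<^sub>R ((a + c) - (a - c))"
    by (simp_all flip: scaleR_2)
  then have a_eq: "a = (k/2) *\<^sub>R U + (l/2) *\<^sub>R W" and c_eq: "c = (k/2) *\<^sub>R U - (l/2) *\<^sub>R W"
    unfolding kl by (simp_all add: scaleR_right_distrib scaleR_right_diff_distrib)
  have refl_a: "line_refl W a = c" unfolding a_eq c_eq by (rule line_refl_orthogonal(1)[OF axes])
  then have "a \<in> \<Gamma>\<^sub>R" using in' c(2) by (simp add: line_refl_image_iff)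
  then obtain i j :: int where ij: "a = of_int i *\<^sub>R U + of_int j *\<^sub>R W" "int q dvd i - j"
    unfolding reflected_part by auto
  have c': "c = of_int i *\<^sub>R U - of_int j *\<^sub>R W"
    using refl_a unfolding ij(1) line_refl_orthogonal(1)[OF axes] by simp
  \<comment> \<open>If i = 0 then a + c = 0, and if j = 0 then a - c = 0, against
    independence.\<close>
  have nz: "i \<noteq> 0" "j \<noteq> 0"
    using c(3)[unfolded coords_unique_def, rule_format, of 1 1] c(3)[unfolded coords_unique_def, rule_format, of 1 "- 1"]
    by (auto simp: ij(1) c')
  define m n where "m = nat \<bar>i\<bar>" and "n = nat \<bar>j\<bar>"
  have mn: "0 < m" "0 < n" using nz by (auto simp: m_def n_def)
  have L_eq: "\<Lambda> = wr_lattice (m, n)"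
    unfolding wr_lattice_def by (simp add: m_def n_def rhombic_abs) (simp add: rhombic_def c(1) ij(1) c')
  have "int q dvd int m - int n"
  proof -
    \<comment> \<open>Passing to absolute values preserves parity, which is enough as q is 1 or
      2.\<close>
    have "even (\<bar>i\<bar> - \<bar>j\<bar>) \<longleftrightarrow> even (i - j)" by presburger
    then show ?thesis using q ij(2) by (auto simp: m_def n_def)
  qed
  moreover have "\<alpha> * real m \<le> real n \<and> real n \<le> \<beta> * real m"
  proof -
    let ?a = "real m *\<^sub>R U + real n *\<^sub>R W" and ?b = "real m *\<^sub>R U - real n *\<^sub>R W"
    \<comment> \<open>The inner products involve only squares of the coordinates, so the signs of i
      and j do not affect the reduction condition.\<close>
    have sq: "real m * real m = of_int i * of_int i" "real n * real n = of_int j * of_int j"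
      by (simp_all add: m_def n_def flip: abs_mult)
    have "?a \<bullet> ?a = a \<bullet> a" "?a \<bullet> ?b = a \<bullet> c"
      unfolding ij(1) c'
      using orthogonal_pair_inner[OF axes, of "real m" "real n" "real m" "real n"]
        orthogonal_pair_inner[OF axes, of "real m" "real n" "real m" "- real n"]
        orthogonal_pair_inner[OF axes, of "of_int i" "of_int j" "of_int i" "of_int j"]
        orthogonal_pair_inner[OF axes, of "of_int i" "of_int j" "of_int i" "- of_int j"]
      by (simp_all add: sq)
    then have "2 * \<bar>?a \<bullet> ?b\<bar> \<le> ?a \<bullet> ?a" using c(4) by simp
    then show ?thesis using rhombic_short_iff[OF axes, of "real m" "real n"] mn unfolding \<alpha>_def \<beta>_def by simp
  qed
  ultimately have "(m, n) \<in> wr_params" using mn by (simp add: wr_params_def)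
  then show ?thesis using L_eq by blast
qed

section \<open>Counting the well-rounded sublattices by index\<close>

lemma well_rounded_sublattices: "{\<Lambda>. sublattice \<Lambda> \<Gamma> \<and> well_rounded \<Lambda>} = wr_lattice ` wr_params"
  using well_rounded_sublattice_param wr_lattice_well_rounded by blast

text \<open>A lattice with parameters m, n has index 2 \<Sigma> m n / q, so an index at most x means
  m n \<le> q x / (2 \<Sigma>). The summatory function then sums the fibres of the index map over
  this set of parameters.\<close>

lemma wr_summatory_eq:
  assumes "\<beta> \<le> real q * x / (2 * real \<Sigma>)"
  shows "wr_summatory \<Gamma> x = real (card (sector_points q \<alpha> \<beta> (real q * x / (2 * real \<Sigma>))))"
proof -
  let ?y = "real q * x / (2 * real \<Sigma>)"
  let ?S = "sector_points q \<alpha> \<beta> ?y"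
  define idx where "idx p = subgroup_index \<Gamma> (wr_lattice p)" for p
  have q0: "q > 0" using q by auto
  have fin: "finite ?S" using finite_sector_points[OF q0 ratio(1,2) assms] .
  have idx_pos: "1 \<le> idx p" if "p \<in> wr_params" for p
    using subgroup_index_pos[OF additive_subgroup_int_span wr_lattice_well_rounded(1)[OF that]] by (simp add: idx_def)
  have S: "?S = {p \<in> wr_params. real (idx p) \<le> x}"
  proof -
    have "real (fst p) * real (snd p) \<le> ?y \<longleftrightarrow> real (idx p) \<le> x" if "p \<in> wr_params" for p
    proof -
      have eq: "real q * real (idx p) = 2 * real \<Sigma> * (real (fst p) * real (snd p))"
        using arg_cong[OF wr_lattice_well_rounded(3)[OF that], of real] by (simp add: idx_def)
      have "real (fst p) * real (snd p) \<le> ?y \<longleftrightarrow> 2 * real \<Sigma> * (real (fst p) * real (snd p)) \<le> real q * x"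
        using \<Sigma>_pos by (simp add: field_simps)
      then show ?thesis unfolding eq[symmetric] using q0 by simp
    qed
    moreover have "?S = {p \<in> wr_params. real (fst p) * real (snd p) \<le> ?y}"
      unfolding sector_points_def wr_params_def by auto
    ultimately show ?thesis by blast
  qed
  have fib: "wr_count \<Gamma> n = card {p \<in> ?S. idx p = n}" if n: "real n \<le> x" for n
  proof -
    have "{\<Lambda>. sublattice \<Lambda> \<Gamma> \<and> well_rounded \<Lambda> \<and> subgroup_index \<Gamma> \<Lambda> = n} = wr_lattice ` {p \<in> wr_params. idx p = n}"
    proof -
      have "{\<Lambda>. sublattice \<Lambda> \<Gamma> \<and> well_rounded \<Lambda> \<and> subgroup_index \<Gamma> \<Lambda> = n} =
          {\<Lambda> \<in> wr_lattice ` wr_params. subgroup_index \<Gamma> \<Lambda> = n}"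
        unfolding well_rounded_sublattices[symmetric] by (simp only: mem_Collect_eq conj_assoc)
      then show ?thesis unfolding idx_def by (simp only: Compr_image_eq)
    qed
    moreover have "inj_on wr_lattice {p \<in> wr_params. idx p = n}"
      using inj_on_wr_lattice by (rule inj_on_subset) auto
    moreover have "{p \<in> wr_params. idx p = n} = {p \<in> ?S. idx p = n}" unfolding S using n by auto
    ultimately show ?thesis unfolding wr_count_def by (simp add: card_image)
  qed
  let ?N = "{n. 1 \<le> n \<and> real n \<le> x}"
  have finN: "finite ?N"
    by (rule finite_subset[of _ "{..nat \<lfloor>x\<rfloor>}"]) (auto simp: le_nat_floor)
  have "wr_summatory \<Gamma> x = (\<Sum>n\<in>?N. \<Sum>p\<in>{p \<in> ?S. idx p = n}. 1)"
    unfolding wr_summatory_def by (rule sum.cong) (auto simp: fib)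
  \<comment> \<open>No parameter is lost by starting the sum at n = 1, since every index is
    positive.\<close>
  also have "\<dots> = (\<Sum>p\<in>?S. 1)"
    by (rule sum.group[OF fin finN]) (use idx_pos S in blast)
  finally show ?thesis by simp
qed

text \<open>The point count at c x with c = q / (2 \<Sigma>) has main term c x ln 3 / (2 q), in
  which q cancels. The threshold \<beta> / c is where the hypothesis \<open>\<beta> \<le> y\<close>
  of the count begins to hold.\<close>

lemma wr_summatory_asymptotic:
  "(\<lambda>x. wr_summatory \<Gamma> x - ln 3 / (4 * real \<Sigma>) * x) \<in> O[at_top](\<lambda>x. sqrt x)"
proof (rule bigoI)
  define C where "C = 1 / sqrt \<alpha> + 3 * sqrt \<beta> + sqrt \<alpha>"
  define c where "c = real q / (2 * real \<Sigma>)"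
  have q0: "q > 0" using q by auto
  have c: "c > 0" using q0 \<Sigma>_pos by (simp add: c_def)
  have "\<forall>\<^sub>F x in at_top. \<beta> / c \<le> x" by (rule eventually_ge_at_top)
  then show "\<forall>\<^sub>F x in at_top. norm (wr_summatory \<Gamma> x - ln 3 / (4 * real \<Sigma>) * x) \<le> (C * sqrt c) * norm (sqrt x)"
  proof eventually_elim
    case (elim x)
    have y: "real q * x / (2 * real \<Sigma>) = c * x" by (simp add: c_def)
    have b: "\<beta> \<le> c * x" using elim c by (simp add: field_simps)
    have "0 < c * x" using b ratio by linarith
    then have "x > 0" using c by (simp add: zero_less_mult_iff)
    have "c * x * ln (\<beta> / \<alpha>) / (2 * real q) = ln 3 / (4 * real \<Sigma>) * x"
      using q0 \<Sigma>_pos by (simp add: ratio(3) c_def field_simps)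
    then have "\<bar>wr_summatory \<Gamma> x - ln 3 / (4 * real \<Sigma>) * x\<bar> \<le> C * sqrt (c * x)"
      using card_sector_points[OF q0 ratio(1,2) b] wr_summatory_eq[of x] b unfolding y C_def by simp
    then show ?case using \<open>x > 0\<close> by (simp add: real_sqrt_mult mult.assoc)
  qed
qed

end

theorem theorem5p12:
  fixes \<Gamma> :: "(real^2) set"
  assumes "planar_lattice \<Gamma>"
    and "\<not> rational_lattice \<Gamma>"
    and "\<exists>\<Lambda>. sublattice \<Lambda> \<Gamma> \<and> well_rounded \<Lambda>"
  shows "(\<exists>R. coincidence_reflections \<Gamma> = {R, \<lambda>y. - R y}) \<and>
    (\<forall>R. coincidence_reflections \<Gamma> = {R, \<lambda>y. - R y} \<longrightarrow>
       (\<lambda>x::real. wr_summatory \<Gamma> x - ln 3 / (4 * real (subgroup_index \<Gamma> (\<Gamma> \<inter> R ` \<Gamma>))) * x)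
         \<in> O[at_top](\<lambda>x. sqrt x))"
proof -
  obtain e1 e2 where e: "coords_unique e1 e2" and G: "\<Gamma> = int_span e1 e2"
    using assms(1) by (auto simp: planar_lattice_def lattice_basis_iff)
  obtain \<Lambda> where L: "sublattice \<Lambda> \<Gamma>" "well_rounded \<Lambda>" using assms(3) by blast
  have L': "additive_subgroup \<Lambda>" "\<Lambda> \<subseteq> \<Gamma>"
    using L(1) unfolding G by (auto simp: sublattice_iff[OF additive_subgroup_int_span])
  obtain a b where ab: "coords_unique a b" "\<Lambda> = int_span a b" "a \<bullet> a = b \<bullet> b"
    using well_rounded_basis[OF L'(1) L(2)] by blast
  have in': "a \<in> int_span e1 e2" "b \<in> int_span e1 e2"
    using L'(2) int_span_gens unfolding ab(2) G by blast+
  \<comment> \<open>The given well-rounded sublattice supplies the orthogonal pair a + b, a - b, and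
    thereby the axes. The vector W is a multiple of a - b, so both define the same
    reflection.\<close>
  obtain U W q where q: "q = 1 \<or> q = 2" and UW: "orthogonal_pair U W"
    and par: "\<exists>k. a - b = k *\<^sub>R W"
    and D: "int_span e1 e2 \<inter> line_refl (a - b) ` int_span e1 e2 =
       {of_int i *\<^sub>R U + of_int j *\<^sub>R W | i j :: int. int q dvd i - j}"
    by (rule reflected_part_structure[OF e orthogonal_pair_of_rhombus[OF ab(1,3)]
        additive_subgroup_add[OF additive_subgroup_int_span in']
        additive_subgroup_diff[OF additive_subgroup_int_span in']])
  have "a - b \<noteq> 0" using orthogonal_pair_of_rhombus[OF ab(1,3)] by (simp add: orthogonal_pair_def)
  moreover obtain k where k: "a - b = k *\<^sub>R W" using par by blast
  ultimately have "line_refl (a - b) = line_refl W" unfolding k by (intro line_refl_scale) auto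
  then interpret axial_lattice e1 e2 U W q
    using e assms(2) q UW D by unfold_locales (simp_all add: G)
  \<comment> \<open>Since the lattice is symmetric under negation, R and -R have the same image of
    it, and \<Sigma> does not depend on which of the two is taken.\<close>
  have same: "R ` int_span e1 e2 = line_refl W ` int_span e1 e2"
    if "coincidence_reflections (int_span e1 e2) = {R, \<lambda>y. - R y}" for R
  proof -
    have neg: "uminus ` int_span e1 e2 = int_span e1 e2"
    proof (intro equalityI subsetI)
      show "x \<in> int_span e1 e2" if "x \<in> uminus ` int_span e1 e2" for x
        using that additive_subgroup_uminus[OF additive_subgroup_int_span] by auto
      show "x \<in> uminus ` int_span e1 e2" if "x \<in> int_span e1 e2" for x
        using additive_subgroup_uminus[OF additive_subgroup_int_span that] by (intro image_eqI[of _ _ "- x"]) auto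
    qed
    have "R = line_refl W \<or> R = (\<lambda>x. - line_refl W x)"
      using that coincidence_reflections by blast
    then show ?thesis
    proof
      assume R: "R = (\<lambda>x. - line_refl W x)"
      have "R ` int_span e1 e2 = line_refl W ` (uminus ` int_span e1 e2)"
        unfolding R image_image by (simp add: linear_neg[OF linear_line_refl])
      then show ?thesis by (simp only: neg)
    qed simp
  qed
  show ?thesis unfolding G
  proof (intro conjI allI impI)
    show "\<exists>R. coincidence_reflections (int_span e1 e2) = {R, \<lambda>y. - R y}"
      by (rule exI[of _ "line_refl W"]) (rule coincidence_reflections)
    fix R assume R: "coincidence_reflections (int_span e1 e2) = {R, \<lambda>y. - R y}"
    show "(\<lambda>x. wr_summatory (int_span e1 e2) x -
        ln 3 / (4 * real (subgroup_index (int_span e1 e2) (int_span e1 e2 \<inter> R ` int_span e1 e2))) * x)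
         \<in> O[at_top](\<lambda>x. sqrt x)"
      unfolding same[OF R] using wr_summatory_asymptotic unfolding \<Sigma>_def .
  qed
qed

end
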